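(* Let $X$ be a topological space, $f,g\colon X\to\mathbb{N}$ continuous functions, $k\in\mathbb{N}$ and $\mathbb{F}$ a field, and assume that the persistence modules $M_f$, $M_g$ and $M_{(f,g)}$ in degree-$k$ homology with coefficients in $\mathbb{F}$ are of finite type. Let $\gamma\colon PD_k(f)\to PD_k(g)$ be a bijection. Then the $\gamma$-product $M_f\circledast_\gamma M_g$ is hook-decomposable.
   Context: Persistence modules. $M_f$ is the monoparameter persistence module obtained by applying singular homology $H_k(\cdot\,;\mathbb{F})$ to the sublevel filtration $\{x\in X : f(x)\le i\}_{i\in\mathbb{N}}$; $M_g$ is defined likewise from $g$; $M_{(f,g)}$ is the biparameter persistence module obtained by applying $H_k(\cdot\,;\mathbb{F})$ to the bifiltration $\{x\in X: f(x)\le i,\ g(x)\le j\}_{(i,j)\in\mathbb{N}^2}$. All persistence modules are assumed to be of finite type and are identified with the corresponding finitely generated graded modules: $M_f$ is an $\mathbb{N}$-graded $\mathbb{F}[x]$-module, $M_g$ an $\mathbb{N}$-graded $\mathbb{F}[y]$-module, and $M_{(f,g)}$ an $\mathbb{N}^2$-graded $\mathbb{F}[x,y]$-module. Persistence diagrams. $PD_k(f)$ is the $k$-th persistence diagram of $f$, i.e. the multiset of pairs $(b,d)$ (with $b\in\mathbb{N}$, $d\in\mathbb{N}\cup\{\infty\}$, $b<d$) recording the births and deaths of the interval summands of $M_f$, together with infinitely many copies of each point $(b,b)$ of the diagonal $\Delta$. $PD_k(g)$ is defined likewise. Generators associated with $\gamma$. For a bijection $\gamma\colon PD_k(f)\to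 PD_k(g)$ of multisets, let $S_\gamma = PD_k(f)\setminus\{(b,b)\in PD_k(f) : \gamma(b,b)\in\Delta\}$ (a finite multiset). Then $M_f$ has the presentation $\langle m_{(b,d)} \mid (b,d)\in S_\gamma,\ \deg(m_{(b,d)})=b,\ m_{(b,d)}x^{d-b}=0\rangle$. Writing $(b',d')=\gamma(b,d)$, the module $M_g$ has an analogous presentation, indexed by $S_{\gamma^{-1}}=\gamma(S_\gamma)$, with generators $m'_{(b',d')}$ of degree $b'$ and relations $m'_{(b',d')}y^{d'-b'}=0$. A relation in which an exponent is $\infty$ is understood as no relation; a generator with $b=d$ is zero. $\gamma$-product. $M_f\circledast_\gamma M_g$ is the $\mathbb{N}^2$-graded $\mathbb{F}[x,y]$-module with the following structure: (1) generators are the pairs $(m_{(b,d)},m'_{(b',d')})$, for $(b,d)\in S_\gamma$ and $(b',d')=\gamma(b,d)$, each of bidegree $(b,b')$; (2) relations are $(m_{(b,d)},m'_{(b',d')})\cdot x^{d-b}y^{d'-b'}=0$ (no relation if $d=\infty$ or $d'=\infty$); (3) addition is component-wise: $(m,m')+(n,n')=(m+n,m'+n')$; (4) the $\mathbb{F}[x,y]$-action and scalar multiplication are given by $(m,m')\cdot s(x,y)=(m\cdot s(x,1),\,m'\cdot s(1,y))$. The pair formulas in (3) and (4) are read bidegree by bidegree: an element of bidegree $(i,j)$ is a pair in $(M_f)_i\oplus(M_g)_j$, addition is that of elements of equal bidegree, and a monomial $x^py^q$ sends $(m,m')$ of bidegree $(i,j)$ to $(mx^p,m'y^q)$ of bidegree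 $(i+p,j+q)$, extended linearly. Hook-decomposable. Endow $\mathbb{N}^2$ with the product order. A hook module is an interval module (equal to $\mathbb{F}$ on its support, with identity maps between points of the support, and zero elsewhere) whose support is of the form $\{\mathbf{r}\in\mathbb{N}^2 : \mathbf{r}\ge\mathbf{p},\ \mathbf{r}\not\ge\mathbf{q}\}$ for some $\mathbf{p},\mathbf{q}\in\mathbb{N}^2\cup\{\infty\}$ with $\mathbf{p}\le\mathbf{q}$ (if $\mathbf{q}=\infty$ the condition $\mathbf{r}\not\ge\mathbf{q}$ is vacuous). A biparameter persistence module is hook-decomposable if it is isomorphic to a direct sum of hook modules. *)

theory Defs
  imports "HOL-Homology.Homology" "HOL-Algebra.Module" "HOL-Library.Multiset"
    "HOL-Library.Extended_Nat" "HOL-Library.Product_Order"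
begin

section \<open>Graded modules over a poset of degrees\<close>

text \<open>
  A persistence module over \<^typ>\<open>'g\<close> is stored as its homogeneous parts together with
  its structure maps. Under the usual identification with graded modules, \<open>shift M i j\<close>
  is multiplication by \<open>x\<^sup>j\<^sup>-\<^sup>i\<close> from degree \<open>i\<close> to degree \<open>j\<close>; for \<open>'g = nat \<times> nat\<close>
  (with the product order) it is multiplication by the monomial whose bidegree is the
  difference of the two bidegrees. The fields \<open>mult\<close> and \<open>one\<close> that
  the library record for modules inherits from rings carry no meaning.
\<close>

record ('g, 'f, 'v) persistence_module =
  part :: "'g \<Rightarrow> ('f, 'v) module"
  shift :: "'g \<Rightarrow> 'g \<Rightarrow> 'v \<Rightarrow> 'v"

definition isomorphic ::
    "('g::order, 'f, 'v) persistence_module \<Rightarrow> ('g, 'f, 'w) persistence_module \<Rightarrow> bool"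
  where "isomorphic M N \<longleftrightarrow> (\<exists>\<phi>.
    (\<forall>i. bij_betw (\<phi> i) (carrier (part M i)) (carrier (part N i))) \<and>
    (\<forall>i. \<forall>v \<in> carrier (part M i). \<forall>w \<in> carrier (part M i).
       \<phi> i (v \<oplus>\<^bsub>part M i\<^esub> w) = \<phi> i v \<oplus>\<^bsub>part N i\<^esub> \<phi> i w) \<and>
    (\<forall>i a. \<forall>v \<in> carrier (part M i).
       \<phi> i (a \<odot>\<^bsub>part M i\<^esub> v) = a \<odot>\<^bsub>part N i\<^esub> \<phi> i v) \<and>
    (\<forall>i j. i \<le> j \<longrightarrow> (\<forall>v \<in> carrier (part M i).
       \<phi> j (shift M i j v) = shift N i j (\<phi> i v))))"

definition direct_sum ::
    "'s set \<Rightarrow> ('s \<Rightarrow> ('g, 'f, 'v) persistence_module) \<Rightarrow> ('g, 'f, 's \<Rightarrow> 'v) persistence_module"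
  where "direct_sum S M = \<lparr>
    part = (\<lambda>i. \<lparr>
      carrier = {v \<in> \<Pi>\<^sub>E s\<in>S. carrier (part (M s) i). finite {s \<in> S. v s \<noteq> \<zero>\<^bsub>part (M s) i\<^esub>}},
      monoid.mult = undefined, one = undefined,
      zero = (\<lambda>s\<in>S. \<zero>\<^bsub>part (M s) i\<^esub>),
      add = (\<lambda>v w. \<lambda>s\<in>S. v s \<oplus>\<^bsub>part (M s) i\<^esub> w s),
      smult = (\<lambda>a v. \<lambda>s\<in>S. a \<odot>\<^bsub>part (M s) i\<^esub> v s)\<rparr>),
    shift = (\<lambda>i j v. \<lambda>s\<in>S. shift (M s) i j (v s))\<rparr>"

definition interval_module :: "'g set \<Rightarrow> ('g, 'f::field, 'f) persistence_module"
  where "interval_module I = \<lparr>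
    part = (\<lambda>i. \<lparr>carrier = (if i \<in> I then UNIV else {0}), monoid.mult = (*), one = 1,
                 zero = 0, add = (+), smult = (*)\<rparr>),
    shift = (\<lambda>i j v. if i \<in> I \<and> j \<in> I then v else 0)\<rparr>"


section \<open>Generators and relations\<close>

text \<open>
  Let \<open>e\<^sub>s\<close> (\<open>s \<in> S\<close>) be free homogeneous generators with degrees \<open>p s\<close>. In degree \<open>i\<close> the
  free graded module on them has the basis \<open>e\<^sub>s x\<^sup>i\<^sup>-\<^sup>p\<^sup>(\<^sup>s\<^sup>)\<close> with \<open>p s \<le> i\<close>, so its
  elements are given by their coefficients. \<open>evaluate\<close> is the degree \<open>i\<close> part of the
  homomorphism that sends \<open>e\<^sub>s\<close> to \<open>m s\<close>.
\<close>

definition free_part :: "'s set \<Rightarrow> ('s \<Rightarrow> 'g::order) \<Rightarrow> 'g \<Rightarrow> ('s \<Rightarrow> 'f::field) set"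
  where "free_part S p i = {c. finite {s. c s \<noteq> 0} \<and> {s. c s \<noteq> 0} \<subseteq> {s \<in> S. p s \<le> i}}"

definition evaluate ::
    "('g::order, 'f::field, 'v) persistence_module \<Rightarrow> ('s \<Rightarrow> 'g) \<Rightarrow> ('s \<Rightarrow> 'v) \<Rightarrow> 'g \<Rightarrow> ('s \<Rightarrow> 'f) \<Rightarrow> 'v"
  where "evaluate M p m i c =
    (\<Oplus>\<^bsub>part M i\<^esub> s \<in> {s. c s \<noteq> 0}. c s \<odot>\<^bsub>part M i\<^esub> shift M (p s) i (m s))"

definition generated_submodule ::
    "('g::order, 'f::field, 'v) persistence_module \<Rightarrow> 's set \<Rightarrow> ('s \<Rightarrow> 'g) \<Rightarrow> ('s \<Rightarrow> 'v) \<Rightarrow>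
     ('g, 'f, 'v) persistence_module"
  where "generated_submodule M S p m =
    M\<lparr>part := \<lambda>i. (part M i)\<lparr>carrier := evaluate M p m i ` free_part S p i\<rparr>\<rparr>"

definition finite_type :: "('g::order, 'f::field, 'v) persistence_module \<Rightarrow> bool"
  where "finite_type M \<longleftrightarrow> (\<exists>G \<subseteq> (SIGMA i:UNIV. carrier (part M i)).
    finite G \<and> (\<forall>i. carrier (part M i) = evaluate M fst snd i ` free_part G fst i))"

text \<open>
  \<open>presented_by M S p q m\<close>: the elements \<open>m s\<close> of degree \<open>p s\<close> generate \<open>M\<close>, and the
  relations among them are generated by \<open>m s x\<^sup>q\<^sup>(\<^sup>s\<^sup>)\<^sup>-\<^sup>p\<^sup>(\<^sup>s\<^sup>) = 0\<close>, with no relation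
  for \<open>s\<close> if \<open>q s\<close> is \<open>None\<close> (infinite). In degree \<open>i\<close> the submodule of the free module generated by the
  elements \<open>e\<^sub>s x\<^sup>q\<^sup>(\<^sup>s\<^sup>)\<^sup>-\<^sup>p\<^sup>(\<^sup>s\<^sup>)\<close> consists of the combinations of those basis elements
  \<open>e\<^sub>s x\<^sup>i\<^sup>-\<^sup>p\<^sup>(\<^sup>s\<^sup>)\<close> with \<open>q s \<le> i\<close>; this is \<open>relation_part\<close>.
\<close>

definition relation_part ::
    "'s set \<Rightarrow> ('s \<Rightarrow> 'g::order option) \<Rightarrow> 'g \<Rightarrow> ('s \<Rightarrow> 'f::field) set"
  where "relation_part S q i = {c. finite {s. c s \<noteq> 0} \<and>
    {s. c s \<noteq> 0} \<subseteq> {s \<in> S. \<exists>d. q s = Some d \<and> d \<le> i}}"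

definition presented_by ::
    "('g::order, 'f::field, 'v) persistence_module \<Rightarrow> 's set \<Rightarrow> ('s \<Rightarrow> 'g) \<Rightarrow> ('s \<Rightarrow> 'g option) \<Rightarrow>
     ('s \<Rightarrow> 'v) \<Rightarrow> bool"
  where "presented_by M S p q m \<longleftrightarrow>
    (\<forall>s\<in>S. m s \<in> carrier (part M (p s))) \<and>
    (\<forall>i. evaluate M p m i ` free_part S p i = carrier (part M i)) \<and>
    (\<forall>i. {c \<in> free_part S p i. evaluate M p m i c = \<zero>\<^bsub>part M i\<^esub>} = relation_part S q i)"


section \<open>Singular homology with field coefficients and sublevel filtrations\<close>

text \<open>The library's singular homology has integer coefficients only.\<close>

type_synonym ('a, 'f) field_chain = "((nat \<Rightarrow> real) \<Rightarrow> 'a) \<Rightarrow>\<^sub>0 'f"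

definition field_chains :: "nat \<Rightarrow> 'a topology \<Rightarrow> ('a, 'f::field) field_chain set"
  where "field_chains k X = {c. Poly_Mapping.keys c \<subseteq> singular_simplex_set k X}"

definition field_boundary :: "nat \<Rightarrow> ('a, 'f::field) field_chain \<Rightarrow> ('a, 'f) field_chain"
  where "field_boundary k c = (if k = 0 then 0 else
    (\<Sum>\<sigma>\<in>Poly_Mapping.keys c. \<Sum>i\<le>k.
       Poly_Mapping.single (singular_face k i \<sigma>) ((-1) ^ i * Poly_Mapping.lookup c \<sigma>)))"

definition field_cycles :: "nat \<Rightarrow> 'a topology \<Rightarrow> ('a, 'f::field) field_chain set"
  where "field_cycles k X = {c \<in> field_chains k X. field_boundary k c = 0}"

definition field_boundaries :: "nat \<Rightarrow> 'a topology \<Rightarrow> ('a, 'f::field) field_chain set"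
  where "field_boundaries k X = field_boundary (Suc k) ` field_chains (Suc k) X"

definition field_homology :: "nat \<Rightarrow> 'a topology \<Rightarrow> ('f::field, ('a, 'f) field_chain set) module"
  where "field_homology k X = \<lparr>
    carrier = (\<lambda>z. {z + b |b. b \<in> field_boundaries k X}) ` field_cycles k X,
    monoid.mult = undefined, one = undefined,
    zero = field_boundaries k X,
    add = (\<lambda>A C. {a + c |a c. a \<in> A \<and> c \<in> C}),
    smult = (\<lambda>r A. {Poly_Mapping.map ((*) r) a + b |a b. a \<in> A \<and> b \<in> field_boundaries k X})\<rparr>"

text \<open>
  For \<open>h = (\<lambda>x. (f x, g x))\<close> and the product order on \<^typ>\<open>nat \<times> nat\<close> this is the
  bifiltration by \<open>f x \<le> i\<close> and \<open>g x \<le> j\<close>.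
\<close>

definition sublevel :: "'a topology \<Rightarrow> ('a \<Rightarrow> 'g::order) \<Rightarrow> 'g \<Rightarrow> 'a topology"
  where "sublevel X h i = subtopology X {x \<in> topspace X. h x \<le> i}"

text \<open>The structure maps are the maps induced by the inclusions of sublevel sets.\<close>

definition sublevel_homology ::
    "nat \<Rightarrow> 'a topology \<Rightarrow> ('a \<Rightarrow> 'g::order) \<Rightarrow>
     ('g, 'f::field, ('a, 'f) field_chain set) persistence_module"
  where "sublevel_homology k X h = \<lparr>
    part = (\<lambda>i. field_homology k (sublevel X h i)),
    shift = (\<lambda>i j A. {a + b |a b. a \<in> A \<and> b \<in> field_boundaries k (sublevel X h j)})\<rparr>"


section \<open>Persistence diagrams\<close>

text \<open>
  Multisets with possibly infinite multiplicities are represented by sets of pairs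
  \<open>(x, n)\<close>, where \<open>n\<close> numbers the copies of \<open>x\<close>. A bijection of multisets is a bijection
  between such sets.
\<close>

type_synonym point = "(nat \<times> enat) \<times> nat"

definition birth :: "point \<Rightarrow> nat"
  where "birth s = fst (fst s)"

definition death :: "point \<Rightarrow> enat"
  where "death s = snd (fst s)"

definition on_diagonal :: "point \<Rightarrow> bool"
  where "on_diagonal s \<longleftrightarrow> death s = enat (birth s)"

definition copies :: "(nat \<times> enat) multiset \<Rightarrow> point set"
  where "copies B = {(x, n). n < count B x}"

definition interval_decomposition ::
    "(nat, 'f::field, 'v) persistence_module \<Rightarrow> (nat \<times> enat) multiset \<Rightarrow> bool"
  where "interval_decomposition M B \<longleftrightarrow>
    (\<forall>(b, d) \<in># B. enat b < d) \<and>
    isomorphic M (direct_sum (copies B)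
      (\<lambda>s. interval_module {i. birth s \<le> i \<and> enat i < death s}))"

text \<open>
  For a module of finite type the multiset in \<open>interval_decomposition\<close> exists and
  is unique.
\<close>

definition barcode :: "(nat, 'f::field, 'v) persistence_module \<Rightarrow> (nat \<times> enat) multiset"
  where "barcode M = (SOME B. interval_decomposition M B)"

definition persistence_diagram :: "(nat, 'f::field, 'v) persistence_module \<Rightarrow> point set"
  where "persistence_diagram M = copies (barcode M) \<union> {s. on_diagonal s}"


section \<open>The product of two persistence modules along a matching\<close>

definition matched_points :: "point set \<Rightarrow> (point \<Rightarrow> point) \<Rightarrow> point set"
  where "matched_points D \<gamma> = D - {s \<in> D. on_diagonal s \<and> on_diagonal (\<gamma> s)}"

fun finite_degree :: "enat \<Rightarrow> nat option"
  where
    "finite_degree (enat d) = Some d"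
  | "finite_degree \<infinity> = None"

definition bar_generators ::
    "(nat, 'f::field, 'v) persistence_module \<Rightarrow> point set \<Rightarrow> (point \<Rightarrow> 'v) \<Rightarrow> bool"
  where "bar_generators M S m \<longleftrightarrow> presented_by M S birth (\<lambda>s. finite_degree (death s)) m"

text \<open>
  In bidegree \<open>(i, j)\<close> the module of pairs is the direct sum of \<open>part M i\<close> and
  \<open>part N j\<close>, with \<open>x\<close> acting on the first and \<open>y\<close> on the second component.
\<close>

definition pair_module ::
    "('g, 'f, 'v) persistence_module \<Rightarrow> ('h, 'f, 'w) persistence_module \<Rightarrow>
     ('g \<times> 'h, 'f, 'v \<times> 'w) persistence_module"
  where "pair_module M N = \<lparr>
    part = (\<lambda>(i, j). \<lparr>
      carrier = carrier (part M i) \<times> carrier (part N j),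
      monoid.mult = undefined, one = undefined,
      zero = (\<zero>\<^bsub>part M i\<^esub>, \<zero>\<^bsub>part N j\<^esub>),
      add = (\<lambda>(v, w) (v', w'). (v \<oplus>\<^bsub>part M i\<^esub> v', w \<oplus>\<^bsub>part N j\<^esub> w')),
      smult = (\<lambda>a (v, w). (a \<odot>\<^bsub>part M i\<^esub> v, a \<odot>\<^bsub>part N j\<^esub> w))\<rparr>),
    shift = (\<lambda>(i, j) (i', j') (v, w). (shift M i i' v, shift N j j' w))\<rparr>"

text \<open>
  The product is the submodule of the module of pairs that is generated by the pairs of
  matched generators.
\<close>

definition product_of_generators ::
    "(nat, 'f::field, 'v) persistence_module \<Rightarrow> (nat, 'f, 'w) persistence_module \<Rightarrow>
     point set \<Rightarrow> (point \<Rightarrow> point) \<Rightarrow> (point \<Rightarrow> 'v) \<Rightarrow> (point \<Rightarrow> 'w) \<Rightarrow>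
     (nat \<times> nat, 'f, 'v \<times> 'w) persistence_module"
  where "product_of_generators M N S \<gamma> m m' =
    generated_submodule (pair_module M N) S
      (\<lambda>s. (birth s, birth (\<gamma> s))) (\<lambda>s. (m s, m' (\<gamma> s)))"

text \<open>
  Generators as in \<open>bar_generators\<close> exist because \<open>S\<close> consists of all off-diagonal points
  of the diagram together with diagonal points, whose generators are zero. The product
  depends on the choice of generators only up to isomorphism.
\<close>

definition gamma_product ::
    "(nat, 'f::field, 'v) persistence_module \<Rightarrow> (point \<Rightarrow> point) \<Rightarrow>
     (nat, 'f, 'w) persistence_module \<Rightarrow> (nat \<times> nat, 'f, 'v \<times> 'w) persistence_module"
  where "gamma_product M \<gamma> N =
    (let S = matched_points (persistence_diagram M) \<gamma>
     in product_of_generators M N S \<gamma>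
          (SOME m. bar_generators M S m) (SOME m'. bar_generators N (\<gamma> ` S) m'))"


section \<open>Hook-decomposable modules\<close>

text \<open>Here \<open>None\<close> is the element \<open>\<infinity>\<close> adjoined on top of the degrees.\<close>

fun ext_le :: "'g::order option \<Rightarrow> 'g option \<Rightarrow> bool"
  where
    "ext_le p None = True"
  | "ext_le None (Some q) = False"
  | "ext_le (Some p) (Some q) = (p \<le> q)"

definition hook :: "(nat \<times> nat) option \<Rightarrow> (nat \<times> nat) option \<Rightarrow> (nat \<times> nat) set"
  where "hook p q = {r. ext_le p (Some r) \<and> \<not> ext_le q (Some r)}"

text \<open>
  A countable index set suffices, as only modules of finite type are considered.
\<close>

definition hook_decomposable :: "(nat \<times> nat, 'f::field, 'v) persistence_module \<Rightarrow> bool"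
  where "hook_decomposable M \<longleftrightarrow>
    (\<exists>(I :: nat set) p q. (\<forall>n\<in>I. ext_le (p n) (q n)) \<and>
       isomorphic M (direct_sum I (\<lambda>n. interval_module (hook (p n) (q n)))))"

section \<open>The relations of the product\<close>

text \<open>
  By construction the product is generated by the pairs of matched generators, with
  componentwise operations. The lemma \<open>product_relations\<close> shows that its relations are
  generated by \<open>(m s, m' (\<gamma> s)) x\<^sup>d\<^sup>-\<^sup>b y\<^sup>d\<^sup>'\<^sup>-\<^sup>b\<^sup>' = 0\<close>, where \<open>(b, d)\<close> is the point \<open>s\<close>
  and \<open>(b', d')\<close> the point \<open>\<gamma> s\<close>, with no relation if \<open>d\<close> or \<open>d'\<close> is infinite.
\<close>

definition product_relation :: "point \<Rightarrow> point \<Rightarrow> (nat \<times> nat) option"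
  where "product_relation s t = (case (death s, death t) of
    (enat d, enat d') \<Rightarrow> Some (d, d') | _ \<Rightarrow> None)"

definition field_ring :: "'f::field ring"
  where "field_ring = \<lparr>carrier = UNIV, monoid.mult = (*), one = 1, zero = 0, add = (+)\<rparr>"

locale graded_module =
  fixes M :: "('g::order, 'f::field, 'v) persistence_module"
  assumes part_module: "Module.module field_ring (part M i)"
    and shift_closed: "\<lbrakk>i \<le> j; v \<in> carrier (part M i)\<rbrakk> \<Longrightarrow> shift M i j v \<in> carrier (part M j)"
    and shift_add: "\<lbrakk>i \<le> j; v \<in> carrier (part M i); w \<in> carrier (part M i)\<rbrakk> \<Longrightarrow>
      shift M i j (v \<oplus>\<^bsub>part M i\<^esub> w) = shift M i j v \<oplus>\<^bsub>part M j\<^esub> shift M i j w"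
    and shift_smult: "\<lbrakk>i \<le> j; v \<in> carrier (part M i)\<rbrakk> \<Longrightarrow>
      shift M i j (a \<odot>\<^bsub>part M i\<^esub> v) = a \<odot>\<^bsub>part M j\<^esub> shift M i j v"
    and shift_refl: "v \<in> carrier (part M i) \<Longrightarrow> shift M i i v = v"
    and shift_trans: "\<lbrakk>i \<le> j; j \<le> l; v \<in> carrier (part M i)\<rbrakk> \<Longrightarrow>
      shift M j l (shift M i j v) = shift M i l v"

lemma field_ring_simps [simp]:
  "carrier field_ring = UNIV" "a \<otimes>\<^bsub>field_ring\<^esub> b = a * b" "\<one>\<^bsub>field_ring\<^esub> = 1"
  "\<zero>\<^bsub>field_ring\<^esub> = 0" "a \<oplus>\<^bsub>field_ring\<^esub> b = a + b"
  by (auto simp: field_ring_def)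

lemma cring_field_ring: "cring field_ring"
  by (intro cringI abelian_groupI comm_monoidI) (auto simp: algebra_simps intro: exI[of _ "- x" for x] exI add.left_inverse)

context graded_module
begin

lemma smult_closed: "v \<in> carrier (part M i) \<Longrightarrow> a \<odot>\<^bsub>part M i\<^esub> v \<in> carrier (part M i)"
  using module.smult_closed[OF part_module] by simp

lemma abelian: "abelian_group (part M i)" using part_module by (simp add: Module.module_def)

lemma amonoid: "abelian_monoid (part M i)" using abelian by (simp add: abelian_group_def)

lemma term_closed:
  assumes "\<forall>s\<in>S. m s \<in> carrier (part M (p s))" "c \<in> free_part S p i"
  shows "(\<lambda>s. c s \<odot>\<^bsub>part M i\<^esub> shift M (p s) i (m s)) \<in> {s. c s \<noteq> 0} \<rightarrow> carrier (part M i)"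
  using assms by (auto simp: free_part_def intro!: smult_closed shift_closed)

lemma evaluate_closed:
  assumes "\<forall>s\<in>S. m s \<in> carrier (part M (p s))" "c \<in> free_part S p i"
  shows "evaluate M p m i c \<in> carrier (part M i)"
  unfolding evaluate_def by (rule abelian_monoid.finsum_closed[OF amonoid term_closed[OF assms]])

end

lemma finsum_pair:
  assumes "graded_module M" "graded_module N" "finite A"
    "f \<in> A \<rightarrow> carrier (part M i)" "h \<in> A \<rightarrow> carrier (part N j)"
    "abelian_monoid (part (pair_module M N) (i,j))"
  shows "finsum (part (pair_module M N) (i,j)) (\<lambda>s. (f s, h s)) A = (finsum (part M i) f A, finsum (part N j) h A)"
  using assms(3-5)
proof (induction A rule: finite_induct)
  case empty
  interpret P: abelian_monoid "part (pair_module M N) (i,j)" by fact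
  interpret A: abelian_monoid "part M i" by (rule graded_module.amonoid[OF assms(1)])
  interpret B: abelian_monoid "part N j" by (rule graded_module.amonoid[OF assms(2)])
  show ?case by (simp only: P.finsum_empty A.finsum_empty B.finsum_empty) (simp add: pair_module_def)
next
  case (insert s A)
  interpret P: abelian_monoid "part (pair_module M N) (i,j)" by fact
  interpret A: abelian_monoid "part M i" by (rule graded_module.amonoid[OF assms(1)])
  interpret B: abelian_monoid "part N j" by (rule graded_module.amonoid[OF assms(2)])
  have "carrier (part (pair_module M N) (i,j)) = carrier (part M i) \<times> carrier (part N j)" by (simp add: pair_module_def)
  moreover have "(a,b) \<oplus>\<^bsub>part (pair_module M N) (i,j)\<^esub> (c,d) = (a \<oplus>\<^bsub>part M i\<^esub> c, b \<oplus>\<^bsub>part N j\<^esub> d)" for a b c d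
    by (simp add: pair_module_def)
  ultimately show ?case using insert by (subst P.finsum_insert) (auto simp: Pi_def)
qed

lemma graded_pair:
  assumes "graded_module M" "graded_module N"
  shows "graded_module (pair_module M N)"
proof -
  interpret A: graded_module M by fact
  interpret B: graded_module N by fact
  have mod: "Module.module field_ring (part (pair_module M N) (i,j))" for i j
  proof -
    interpret P: module field_ring "part M i" by (rule A.part_module)
    interpret Q: module field_ring "part N j" by (rule B.part_module)
    show ?thesis
    proof (rule moduleI[OF cring_field_ring])
      show "abelian_group (part (pair_module M N) (i,j))"
      proof (rule abelian_groupI, goal_cases)
        case (6 x)
        then show ?case 
          by (auto simp: pair_module_def intro!: bexI[of _ "(\<ominus>\<^bsub>part M i\<^esub> (fst x), \<ominus>\<^bsub>part N j\<^esub> (snd x))"] P.M.l_neg Q.M.l_neg)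
      qed (auto simp: pair_module_def P.M.a_assoc Q.M.a_assoc intro: P.M.a_comm Q.M.a_comm)
    qed (use P.smult_l_distr Q.smult_l_distr P.smult_r_distr Q.smult_r_distr P.smult_assoc1 Q.smult_assoc1 P.smult_closed Q.smult_closed P.smult_one Q.smult_one
        in \<open>auto simp: pair_module_def\<close>)
  qed
  show ?thesis
    by (rule graded_module.intro)
     (use mod in \<open>auto simp: pair_module_def A.shift_closed B.shift_closed A.shift_add B.shift_add A.shift_smult B.shift_smult
       A.shift_refl B.shift_refl A.shift_trans B.shift_trans\<close>)
qed

lemma evaluate_pair:
  assumes M: "graded_module M" and N: "graded_module N"
    and m: "\<forall>s\<in>S. m s \<in> carrier (part M (p s))" and m': "\<forall>s\<in>S. m' s \<in> carrier (part N (p' s))"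
    and c: "c \<in> free_part S (\<lambda>s. (p s, p' s)) (i, j)"
  shows "evaluate (pair_module M N) (\<lambda>s. (p s, p' s)) (\<lambda>s. (m s, m' s)) (i, j) c
    = (evaluate M p m i c, evaluate N p' m' j c)"
proof -
  have cs: "c \<in> free_part S p i" "c \<in> free_part S p' j" using c by (auto simp: free_part_def)
  have 1: "c s \<odot>\<^bsub>part (pair_module M N) (i,j)\<^esub> shift (pair_module M N) (p s, p' s) (i,j) (m s, m' s)
    = (c s \<odot>\<^bsub>part M i\<^esub> shift M (p s) i (m s), c s \<odot>\<^bsub>part N j\<^esub> shift N (p' s) j (m' s))" for s
    by (simp add: pair_module_def)
  show ?thesis unfolding evaluate_def 1
    by (rule finsum_pair[OF M N _ graded_module.term_closed[OF M m cs(1)] graded_module.term_closed[OF N m' cs(2)]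
       graded_module.amonoid[OF graded_pair[OF M N]]])
      (use c in \<open>auto simp: free_part_def\<close>)
qed

lemma evaluate_reindex:
  assumes N: "graded_module N" and inj: "inj_on \<gamma> S"
    and m': "\<forall>t\<in>\<gamma> ` S. m' t \<in> carrier (part N (p' t))"
    and c: "c \<in> free_part S (\<lambda>s. p' (\<gamma> s)) j"
  defines "e \<equiv> (\<lambda>t. if t \<in> \<gamma> ` S then c (the_inv_into S \<gamma> t) else 0)"
  shows "e \<in> free_part (\<gamma> ` S) p' j" "{t. e t \<noteq> 0} = \<gamma> ` {s. c s \<noteq> 0}"
    "evaluate N (\<lambda>s. p' (\<gamma> s)) (\<lambda>s. m' (\<gamma> s)) j c = evaluate N p' m' j e"
proof -
  have inv: "the_inv_into S \<gamma> (\<gamma> s) = s" if "s \<in> S" for s using the_inv_into_f_f[OF inj that] .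
  have sub: "{s. c s \<noteq> 0} \<subseteq> S" using c by (auto simp: free_part_def)
  show supp: "{t. e t \<noteq> 0} = \<gamma> ` {s. c s \<noteq> 0}" using sub inj_onD[OF inj] by (force simp: e_def inv split: if_splits)
  show e: "e \<in> free_part (\<gamma> ` S) p' j" using c unfolding free_part_def mem_Collect_eq supp by auto
  interpret N: graded_module N by fact
  have "evaluate N p' m' j e = (\<Oplus>\<^bsub>part N j\<^esub> t \<in> \<gamma> ` {s. c s \<noteq> 0}. e t \<odot>\<^bsub>part N j\<^esub> shift N (p' t) j (m' t))"
    unfolding evaluate_def supp ..
  also have "\<dots> = (\<Oplus>\<^bsub>part N j\<^esub> s \<in> {s. c s \<noteq> 0}. e (\<gamma> s) \<odot>\<^bsub>part N j\<^esub> shift N (p' (\<gamma> s)) j (m' (\<gamma> s)))"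
    by (rule abelian_monoid.finsum_reindex[OF N.amonoid])
      (use N.term_closed[OF m' e] inj_on_subset[OF inj sub] in \<open>auto simp: supp\<close>)
  also have "\<dots> = (\<Oplus>\<^bsub>part N j\<^esub> s \<in> {s. c s \<noteq> 0}. c s \<odot>\<^bsub>part N j\<^esub> shift N (p' (\<gamma> s)) j (m' (\<gamma> s)))"
  proof (rule abelian_monoid.finsum_cong'[OF N.amonoid refl])
    show "(\<lambda>s. c s \<odot>\<^bsub>part N j\<^esub> shift N (p' (\<gamma> s)) j (m' (\<gamma> s))) \<in> {s. c s \<noteq> 0} \<rightarrow> carrier (part N j)"
      using N.term_closed[of S "\<lambda>s. m' (\<gamma> s)" "\<lambda>s. p' (\<gamma> s)", OF _ c] m' by auto
  next
    fix s assume "s \<in> {s. c s \<noteq> 0}"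
    then have "s \<in> S" using sub by auto
    then have "e (\<gamma> s) = c s" by (simp add: e_def inv)
    then show "e (\<gamma> s) \<odot>\<^bsub>part N j\<^esub> shift N (p' (\<gamma> s)) j (m' (\<gamma> s)) = c s \<odot>\<^bsub>part N j\<^esub> shift N (p' (\<gamma> s)) j (m' (\<gamma> s))" by simp
  qed
  finally show "evaluate N (\<lambda>s. p' (\<gamma> s)) (\<lambda>s. m' (\<gamma> s)) j c = evaluate N p' m' j e"
    unfolding evaluate_def by simp
qed

lemma presented_zero_iff:
  assumes "presented_by M S p q m" "c \<in> free_part S p i"
  shows "evaluate M p m i c = \<zero>\<^bsub>part M i\<^esub> \<longleftrightarrow> c \<in> relation_part S q i"
  using assms unfolding presented_by_def by blast

lemma finite_degree_le: "(\<exists>d. finite_degree e = Some d \<and> d \<le> i) \<longleftrightarrow> e \<le> enat i"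
  by (cases e) auto

lemma product_relation_le:
  "(\<exists>d. product_relation s t = Some d \<and> d \<le> (i, j)) \<longleftrightarrow> death s \<le> enat i \<and> death t \<le> enat j"
  unfolding product_relation_def by (cases "death s"; cases "death t") auto

lemma product_relations:
  assumes M: "graded_module M" and N: "graded_module N"
    and inj: "inj_on \<gamma> S"
    and m: "bar_generators M S m" and m': "bar_generators N (\<gamma> ` S) m'"
    and c: "c \<in> free_part S (\<lambda>s. (birth s, birth (\<gamma> s))) (i, j)"
  shows "evaluate (pair_module M N) (\<lambda>s. (birth s, birth (\<gamma> s))) (\<lambda>s. (m s, m' (\<gamma> s))) (i, j) c
       = \<zero>\<^bsub>part (pair_module M N) (i, j)\<^esub>
    \<longleftrightarrow> c \<in> relation_part S (\<lambda>s. product_relation s (\<gamma> s)) (i, j)"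
proof -
  have mc: "\<forall>s\<in>S. m s \<in> carrier (part M (birth s))" and m'c: "\<forall>t\<in>\<gamma> ` S. m' t \<in> carrier (part N (birth t))"
    using m m' by (auto simp: bar_generators_def presented_by_def)
  have cs: "c \<in> free_part S birth i" "c \<in> free_part S (\<lambda>s. birth (\<gamma> s)) j" using c by (auto simp: free_part_def)
  note e = evaluate_reindex[OF N inj m'c cs(2)]
  let ?e = "(\<lambda>t. if t \<in> \<gamma> ` S then c (the_inv_into S \<gamma> t) else 0)"
  have z: "\<zero>\<^bsub>part (pair_module M N) (i, j)\<^esub> = (\<zero>\<^bsub>part M i\<^esub>, \<zero>\<^bsub>part N j\<^esub>)" by (simp add: pair_module_def)
  have "evaluate M birth m i c = \<zero>\<^bsub>part M i\<^esub> \<longleftrightarrow> c \<in> relation_part S (\<lambda>s. finite_degree (death s)) i"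
    using presented_zero_iff[OF m[unfolded bar_generators_def] cs(1)] .
  moreover have "evaluate N birth m' j ?e = \<zero>\<^bsub>part N j\<^esub> \<longleftrightarrow> ?e \<in> relation_part (\<gamma> ` S) (\<lambda>s. finite_degree (death s)) j"
    using presented_zero_iff[OF m'[unfolded bar_generators_def] e(1)] .
  moreover have "?e \<in> relation_part (\<gamma> ` S) (\<lambda>s. finite_degree (death s)) j
     \<longleftrightarrow> finite {s. c s \<noteq> 0} \<and> {s. c s \<noteq> 0} \<subseteq> {s \<in> S. death (\<gamma> s) \<le> enat j}"
    unfolding relation_part_def mem_Collect_eq e(2) finite_degree_le
    using c by (auto simp: free_part_def)
  ultimately show ?thesis
    unfolding z evaluate_pair[OF M N mc m'c[unfolded ball_simps] c] e(3)
    unfolding relation_part_def finite_degree_le product_relation_le mem_Collect_eq by auto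
qed

end

theory Submission
  imports Defs
begin

text \<open>
  A graded module that is generated by elements \<open>m\<^sub>s\<close> of degree \<open>p\<^sub>s\<close>, and whose relations
  are generated by monomial multiples of single generators, at most one for each, splits as
  the direct sum of the cyclic modules generated by the \<open>m\<^sub>s\<close>: in every degree, the coefficients at the
  generators that are still alive are coordinates (\<open>isomorphic_generated_submodule\<close>). A
  cyclic module that is born in degree \<open>p\<close> and killed in degree \<open>q\<close> is the interval module
  on \<open>{r. p \<le> r \<and> \<not> q \<le> r}\<close>, and for bidegrees this is a hook. The product of two
  persistence modules along a matching is generated by the pairs of matched generators, and
  by \<open>product_relations\<close> its relations are of this monomial form. Hence it is a direct sum
  of hooks.

  This argument applies to modules that have a barcode and generators adapted to their
  diagrams, both of which enter the product through a choice operator; so their existence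
  has to be shown. Homology of sublevel sets is a graded module because cycles and
  boundaries are subspaces that grow with the sublevel set
  (\<open>graded_module_sublevel_homology\<close>). A graded module of finite type over \<^typ>\<open>nat\<close> is a sum
  of intervals by the structure theorem for graded modules over a polynomial ring in one
  variable (\<open>exists_interval_decomposition\<close>). It is proved by exchanging generators: if some
  relation in degree \<open>i\<close> is not a consequence of the annihilators of the single generators,
  then the youngest generator with a nonzero term in it can be replaced by a combination of
  generators that dies by degree \<open>i\<close>, before the replaced generator did. The degrees of the
  generators do not change, so lifetimes can only shrink finitely often, and the generators
  that are reached in the end have monomial relations only. Conversely the unit vectors of a
  direct sum of intervals are generators with monomial relations
  (\<open>isomorphic_imp_presented\<close>).
\<close>

section \<open>Linearity of evaluation\<close>

lemma free_part_add:
  "\<lbrakk>c \<in> free_part S p i; d \<in> free_part S p i\<rbrakk> \<Longrightarrow> (\<lambda>s. c s + d s) \<in> free_part S p i"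
  unfolding free_part_def
  using finite_subset[of "{s. c s + d s \<noteq> 0}" "{s. c s \<noteq> 0} \<union> {s. d s \<noteq> 0}"]
  by (force simp: subset_iff)

lemma free_part_scale: "c \<in> free_part S p i \<Longrightarrow> (\<lambda>s. a * c s) \<in> free_part S p i"
  unfolding free_part_def by (auto intro: finite_subset[of _ "{s. c s \<noteq> 0}"])

lemma free_part_mono: "\<lbrakk>c \<in> free_part S p i; i \<le> j\<rbrakk> \<Longrightarrow> c \<in> free_part S p j"
  unfolding free_part_def by (auto intro: order_trans)

text \<open>
  Two forms of the same induction: the first is for maps between degree parts (scalars, structure
  maps), the second for coordinate functions with values in the field.
\<close>

lemma finsum_additive:
  assumes A: "abelian_monoid A" and B: "abelian_monoid B" and "finite S"
    and "f \<in> S \<rightarrow> carrier A"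
    and h: "\<And>v. v \<in> carrier A \<Longrightarrow> h v \<in> carrier B" "h \<zero>\<^bsub>A\<^esub> = \<zero>\<^bsub>B\<^esub>"
      "\<And>v w. \<lbrakk>v \<in> carrier A; w \<in> carrier A\<rbrakk> \<Longrightarrow> h (v \<oplus>\<^bsub>A\<^esub> w) = h v \<oplus>\<^bsub>B\<^esub> h w"
  shows "h (finsum A f S) = finsum B (\<lambda>s. h (f s)) S"
  using assms(3,4)
proof (induction S rule: finite_induct)
  case empty
  show ?case
    by (simp add: abelian_monoid.finsum_empty[OF A] abelian_monoid.finsum_empty[OF B] h)
next
  case (insert s S)
  have "(\<lambda>s. h (f s)) \<in> S \<rightarrow> carrier B"
    using insert.prems h(1) by auto
  with insert show ?case
    by (subst abelian_monoid.finsum_insert[OF A], auto simp: Pi_def abelian_monoid.finsum_insert[OF B] 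
        abelian_monoid.finsum_closed[OF A] h)
qed

lemma finsum_coordinate:
  fixes h :: "'v \<Rightarrow> 'f::field"
  assumes A: "abelian_monoid A" and "finite S" and "f \<in> S \<rightarrow> carrier A"
    and h: "\<And>v w. \<lbrakk>v \<in> carrier A; w \<in> carrier A\<rbrakk> \<Longrightarrow> h (v \<oplus>\<^bsub>A\<^esub> w) = h v + h w"
  shows "h (finsum A f S) = (\<Sum>s\<in>S. h (f s))"
  using assms(2,3)
proof (induction S rule: finite_induct)
  case empty
  have "h \<zero>\<^bsub>A\<^esub> = h \<zero>\<^bsub>A\<^esub> + h \<zero>\<^bsub>A\<^esub>"
    using h[of "\<zero>\<^bsub>A\<^esub>" "\<zero>\<^bsub>A\<^esub>"] abelian_monoid.zero_closed[OF A] abelian_monoid.l_zero[OF A] by metis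
  then have "h \<zero>\<^bsub>A\<^esub> = 0"
    by (metis add_cancel_right_right)
  then show ?case
    by (simp add: abelian_monoid.finsum_empty[OF A])
next
  case (insert s S)
  then show ?case
    by (subst abelian_monoid.finsum_insert[OF A])
      (auto simp: Pi_def abelian_monoid.finsum_closed[OF A] h)
qed

context graded_module
begin

lemma zero_smult: "v \<in> carrier (part M i) \<Longrightarrow> 0 \<odot>\<^bsub>part M i\<^esub> v = \<zero>\<^bsub>part M i\<^esub>"
  using module.smult_l_null[OF part_module] by simp

lemma smult_zero: "a \<odot>\<^bsub>part M i\<^esub> \<zero>\<^bsub>part M i\<^esub> = \<zero>\<^bsub>part M i\<^esub>"
  using module.smult_r_null[OF part_module] by simp

lemma zero_closed: "\<zero>\<^bsub>part M i\<^esub> \<in> carrier (part M i)"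
  by (rule abelian_monoid.zero_closed[OF amonoid])

lemma shift_zero: "i \<le> j \<Longrightarrow> shift M i j \<zero>\<^bsub>part M i\<^esub> = \<zero>\<^bsub>part M j\<^esub>"
  using shift_smult[of i j "\<zero>\<^bsub>part M i\<^esub>" 0] shift_closed[OF _ zero_closed, of i j]
  by (simp add: zero_smult zero_closed)

text \<open>
  \<open>evaluate\<close> sums over the support of the coefficients, which varies with them. Padding with
  zero terms gives combinations with different supports a common index set; the linearity of
  \<open>evaluate\<close> below rests on this.
\<close>

lemma evaluate_superset:
  assumes m: "\<forall>s\<in>S. m s \<in> carrier (part M (p s))"
    and A: "finite A" "{s. c s \<noteq> 0} \<subseteq> A" "A \<subseteq> {s \<in> S. p s \<le> i}"
  shows "evaluate M p m i c = (\<Oplus>\<^bsub>part M i\<^esub> s \<in> A. c s \<odot>\<^bsub>part M i\<^esub> shift M (p s) i (m s))"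
proof -
  interpret abelian_monoid "part M i" by (rule amonoid)
  show ?thesis
    unfolding evaluate_def
    by (rule add.finprod_mono_neutral_cong_left)
      (use assms in \<open>auto intro!: zero_smult smult_closed shift_closed\<close>)
qed

lemma evaluate_add:
  assumes m: "\<forall>s\<in>S. m s \<in> carrier (part M (p s))"
    and c: "c \<in> free_part S p i" and d: "d \<in> free_part S p i"
  shows "evaluate M p m i (\<lambda>s. c s + d s) = evaluate M p m i c \<oplus>\<^bsub>part M i\<^esub> evaluate M p m i d"
proof -
  let ?A = "{s. c s \<noteq> 0} \<union> {s. d s \<noteq> 0}"
  have A: "finite ?A" "?A \<subseteq> {s \<in> S. p s \<le> i}"
    using c d by (auto simp: free_part_def)
  have cl: "shift M (p s) i (m s) \<in> carrier (part M i)" if "s \<in> ?A" for s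
    using A m that by (auto intro!: shift_closed)
  have "evaluate M p m i (\<lambda>s. c s + d s)
      = (\<Oplus>\<^bsub>part M i\<^esub> s \<in> ?A. (c s + d s) \<odot>\<^bsub>part M i\<^esub> shift M (p s) i (m s))"
    by (rule evaluate_superset[OF m A(1) _ A(2)]) auto
  also have "\<dots> = (\<Oplus>\<^bsub>part M i\<^esub> s \<in> ?A. c s \<odot>\<^bsub>part M i\<^esub> shift M (p s) i (m s)
      \<oplus>\<^bsub>part M i\<^esub> d s \<odot>\<^bsub>part M i\<^esub> shift M (p s) i (m s))"
    by (rule abelian_monoid.finsum_cong'[OF amonoid refl])
      (use cl module.smult_l_distr[OF part_module] in \<open>auto intro!: smult_closed
        abelian_monoid.a_closed[OF amonoid]\<close>)
  also have "\<dots> = (\<Oplus>\<^bsub>part M i\<^esub> s \<in> ?A. c s \<odot>\<^bsub>part M i\<^esub> shift M (p s) i (m s))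
      \<oplus>\<^bsub>part M i\<^esub> (\<Oplus>\<^bsub>part M i\<^esub> s \<in> ?A. d s \<odot>\<^bsub>part M i\<^esub> shift M (p s) i (m s))"
    by (rule abelian_monoid.finsum_addf[OF amonoid]) (use cl in \<open>auto intro!: smult_closed\<close>)
  also have "\<dots> = evaluate M p m i c \<oplus>\<^bsub>part M i\<^esub> evaluate M p m i d"
    using evaluate_superset[OF m A(1) _ A(2), of c] evaluate_superset[OF m A(1) _ A(2), of d]
    by auto
  finally show ?thesis .
qed

lemma evaluate_smult:
  assumes m: "\<forall>s\<in>S. m s \<in> carrier (part M (p s))" and c: "c \<in> free_part S p i"
  shows "evaluate M p m i (\<lambda>s. a * c s) = a \<odot>\<^bsub>part M i\<^esub> evaluate M p m i c"
proof -
  let ?A = "{s. c s \<noteq> 0}"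
  have A: "finite ?A" "?A \<subseteq> {s \<in> S. p s \<le> i}"
    using c by (auto simp: free_part_def)
  have cl: "shift M (p s) i (m s) \<in> carrier (part M i)" if "s \<in> ?A" for s
    using A m that by (auto intro!: shift_closed)
  have "a \<odot>\<^bsub>part M i\<^esub> evaluate M p m i c
      = (\<Oplus>\<^bsub>part M i\<^esub> s \<in> ?A. a \<odot>\<^bsub>part M i\<^esub> (c s \<odot>\<^bsub>part M i\<^esub> shift M (p s) i (m s)))"
    unfolding evaluate_def
    by (rule finsum_additive[OF amonoid amonoid A(1) term_closed[OF m c]])
      (use module.smult_r_distr[OF part_module] in \<open>auto intro: smult_closed smult_zero\<close>)
  also have "\<dots> = (\<Oplus>\<^bsub>part M i\<^esub> s \<in> ?A. (a * c s) \<odot>\<^bsub>part M i\<^esub> shift M (p s) i (m s))"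
    by (rule abelian_monoid.finsum_cong'[OF amonoid refl])
      (use cl module.smult_assoc1[OF part_module] in \<open>auto intro!: smult_closed\<close>)
  also have "\<dots> = evaluate M p m i (\<lambda>s. a * c s)"
    by (rule evaluate_superset[OF m A(1) _ A(2), symmetric]) auto
  finally show ?thesis by simp
qed

lemma shift_evaluate:
  assumes m: "\<forall>s\<in>S. m s \<in> carrier (part M (p s))" and c: "c \<in> free_part S p i" and ij: "i \<le> j"
  shows "shift M i j (evaluate M p m i c) = evaluate M p m j c"
proof -
  let ?A = "{s. c s \<noteq> 0}"
  have A: "finite ?A" "?A \<subseteq> {s \<in> S. p s \<le> i}"
    using c by (auto simp: free_part_def)
  have "shift M i j (evaluate M p m i c)
      = (\<Oplus>\<^bsub>part M j\<^esub> s \<in> ?A. shift M i j (c s \<odot>\<^bsub>part M i\<^esub> shift M (p s) i (m s)))"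
    unfolding evaluate_def
    by (rule finsum_additive[OF amonoid amonoid A(1) term_closed[OF m c]])
      (use ij in \<open>auto intro: shift_closed shift_zero shift_add\<close>)
  also have "\<dots> = evaluate M p m j c"
    unfolding evaluate_def
  proof (rule abelian_monoid.finsum_cong'[OF amonoid refl term_closed[OF m free_part_mono[OF c ij]]])
    fix s assume "s \<in> ?A"
    then have s: "p s \<le> i" "m s \<in> carrier (part M (p s))"
      using A m by auto
    then show "shift M i j (c s \<odot>\<^bsub>part M i\<^esub> shift M (p s) i (m s))
        = c s \<odot>\<^bsub>part M j\<^esub> shift M (p s) j (m s)"
      using ij by (simp add: shift_smult shift_closed shift_trans)
  qed
  finally show ?thesis .
qed

text \<open>
  Reduces equality of two combinations to a relation, which a presentation describes.
\<close>

lemma evaluate_eq_iff: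
  assumes m: "\<forall>s\<in>S. m s \<in> carrier (part M (p s))"
    and c: "c \<in> free_part S p i" and d: "d \<in> free_part S p i"
  shows "evaluate M p m i c = evaluate M p m i d
    \<longleftrightarrow> evaluate M p m i (\<lambda>s. c s - d s) = \<zero>\<^bsub>part M i\<^esub>"
proof -
  interpret abelian_group "part M i" by (rule abelian)
  have "(\<lambda>s. - 1 * d s) \<in> free_part S p i"
    by (rule free_part_scale[OF d])
  from free_part_add[OF c this] have e: "(\<lambda>s. c s - d s) \<in> free_part S p i"
    by simp
  have "evaluate M p m i c = evaluate M p m i (\<lambda>s. c s - d s) \<oplus>\<^bsub>part M i\<^esub> evaluate M p m i d"
    using evaluate_add[OF m e d] by simp
  then show ?thesis
    using evaluate_closed[OF m e] evaluate_closed[OF m d] by (metis add.r_cancel_one')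
qed

end


section \<open>Presentations with monomial relations and sums of interval modules\<close>

text \<open>
  The degrees in which a generator of degree \<open>b\<close> with annihilator in degree \<open>d\<close> is nonzero:
  an interval for \<^typ>\<open>nat\<close>, a hook for \<^typ>\<open>nat \<times> nat\<close>.
\<close>

definition survival :: "'g::order \<Rightarrow> 'g option \<Rightarrow> 'g set" where
  "survival b d = {r. b \<le> r \<and> \<not> (\<exists>e. d = Some e \<and> e \<le> r)}"

lemma direct_sum_simps:
  "carrier (part (direct_sum S N) i)
    = {v \<in> \<Pi>\<^sub>E s\<in>S. carrier (part (N s) i). finite {s \<in> S. v s \<noteq> \<zero>\<^bsub>part (N s) i\<^esub>}}"
  "v \<oplus>\<^bsub>part (direct_sum S N) i\<^esub> w = (\<lambda>s\<in>S. v s \<oplus>\<^bsub>part (N s) i\<^esub> w s)"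
  "a \<odot>\<^bsub>part (direct_sum S N) i\<^esub> v = (\<lambda>s\<in>S. a \<odot>\<^bsub>part (N s) i\<^esub> v s)"
  "shift (direct_sum S N) i j v = (\<lambda>s\<in>S. shift (N s) i j (v s))"
  by (simp_all add: direct_sum_def)

lemma interval_module_simps:
  "carrier (part (interval_module I) i) = (if i \<in> I then UNIV else {0})"
  "\<zero>\<^bsub>part (interval_module I) i\<^esub> = 0"
  "a \<oplus>\<^bsub>part (interval_module I) i\<^esub> b = a + b"
  "a \<odot>\<^bsub>part (interval_module I) i\<^esub> b = a * b"
  "shift (interval_module I) i j a = (if i \<in> I \<and> j \<in> I then a else 0)"
  by (simp_all add: interval_module_def)

lemma isomorphicE:
  assumes "isomorphic M N"
  obtains \<phi> where "\<And>i. bij_betw (\<phi> i) (carrier (part M i)) (carrier (part N i))"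
    "\<And>i v w. \<lbrakk>v \<in> carrier (part M i); w \<in> carrier (part M i)\<rbrakk> \<Longrightarrow>
       \<phi> i (v \<oplus>\<^bsub>part M i\<^esub> w) = \<phi> i v \<oplus>\<^bsub>part N i\<^esub> \<phi> i w"
    "\<And>i a v. v \<in> carrier (part M i) \<Longrightarrow> \<phi> i (a \<odot>\<^bsub>part M i\<^esub> v) = a \<odot>\<^bsub>part N i\<^esub> \<phi> i v"
    "\<And>i j v. \<lbrakk>i \<le> j; v \<in> carrier (part M i)\<rbrakk> \<Longrightarrow> \<phi> j (shift M i j v) = shift N i j (\<phi> i v)"
proof -
  from assms[unfolded isomorphic_def] obtain \<phi> where \<phi>:
    "(\<forall>i. bij_betw (\<phi> i) (carrier (part M i)) (carrier (part N i))) \<and>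
    (\<forall>i. \<forall>v \<in> carrier (part M i). \<forall>w \<in> carrier (part M i).
       \<phi> i (v \<oplus>\<^bsub>part M i\<^esub> w) = \<phi> i v \<oplus>\<^bsub>part N i\<^esub> \<phi> i w) \<and>
    (\<forall>i a. \<forall>v \<in> carrier (part M i).
       \<phi> i (a \<odot>\<^bsub>part M i\<^esub> v) = a \<odot>\<^bsub>part N i\<^esub> \<phi> i v) \<and>
    (\<forall>i j. i \<le> j \<longrightarrow> (\<forall>v \<in> carrier (part M i).
       \<phi> j (shift M i j v) = shift N i j (\<phi> i v)))" ..
  show thesis
    by (rule that[of \<phi>]) (use \<phi> in simp_all)
qed

lemma isomorphic_trans:
  assumes "isomorphic L M" and "isomorphic M N"
  shows "isomorphic L N"
proof -
  obtain \<phi> where \<phi>: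
    "\<And>i. bij_betw (\<phi> i) (carrier (part L i)) (carrier (part M i))"
    "\<And>i v w. \<lbrakk>v \<in> carrier (part L i); w \<in> carrier (part L i)\<rbrakk> \<Longrightarrow>
       \<phi> i (v \<oplus>\<^bsub>part L i\<^esub> w) = \<phi> i v \<oplus>\<^bsub>part M i\<^esub> \<phi> i w"
    "\<And>i a v. v \<in> carrier (part L i) \<Longrightarrow> \<phi> i (a \<odot>\<^bsub>part L i\<^esub> v) = a \<odot>\<^bsub>part M i\<^esub> \<phi> i v"
    "\<And>i j v. \<lbrakk>i \<le> j; v \<in> carrier (part L i)\<rbrakk> \<Longrightarrow> \<phi> j (shift L i j v) = shift M i j (\<phi> i v)"
    by (rule isomorphicE[OF assms(1)]) (rule that)
  obtain \<psi> where \<psi>: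
    "\<And>i. bij_betw (\<psi> i) (carrier (part M i)) (carrier (part N i))"
    "\<And>i v w. \<lbrakk>v \<in> carrier (part M i); w \<in> carrier (part M i)\<rbrakk> \<Longrightarrow>
       \<psi> i (v \<oplus>\<^bsub>part M i\<^esub> w) = \<psi> i v \<oplus>\<^bsub>part N i\<^esub> \<psi> i w"
    "\<And>i a v. v \<in> carrier (part M i) \<Longrightarrow> \<psi> i (a \<odot>\<^bsub>part M i\<^esub> v) = a \<odot>\<^bsub>part N i\<^esub> \<psi> i v"
    "\<And>i j v. \<lbrakk>i \<le> j; v \<in> carrier (part M i)\<rbrakk> \<Longrightarrow> \<psi> j (shift M i j v) = shift N i j (\<psi> i v)"
    by (rule isomorphicE[OF assms(2)]) (rule that)
  have "\<phi> i v \<in> carrier (part M i)" if "v \<in> carrier (part L i)" for i v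
    using bij_betwE[OF \<phi>(1)] that by blast
  then show ?thesis
    unfolding isomorphic_def
    by (intro exI[of _ "\<lambda>i. \<psi> i \<circ> \<phi> i"])
      (auto simp: \<phi> \<psi> intro: bij_betw_trans[OF \<phi>(1) \<psi>(1)])
qed

lemma isomorphic_direct_sum_reindex:
  assumes \<sigma>: "bij_betw \<sigma> T S" and N: "\<And>t. t \<in> T \<Longrightarrow> N t = M (\<sigma> t)"
  shows "isomorphic (direct_sum S M) (direct_sum T N)"
proof -
  define \<tau> where "\<tau> = the_inv_into T \<sigma>"
  have \<tau>: "\<tau> s \<in> T" "\<sigma> (\<tau> s) = s" if "s \<in> S" for s
    using \<sigma> that unfolding \<tau>_def
    by (auto simp: bij_betw_def intro: the_inv_into_into f_the_inv_into_f)
  have \<tau>': "\<tau> (\<sigma> t) = t" "\<sigma> t \<in> S" if "t \<in> T" for t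
    using \<sigma> that unfolding \<tau>_def by (auto simp: bij_betw_def the_inv_into_f_f)
  have "bij_betw (\<lambda>v. \<lambda>t\<in>T. v (\<sigma> t)) (carrier (part (direct_sum S M) i))
      (carrier (part (direct_sum T N) i))" for i
  proof (rule bij_betw_byWitness[where f' = "\<lambda>w. \<lambda>s\<in>S. w (\<tau> s)"])
    show "\<forall>v\<in>carrier (part (direct_sum S M) i). (\<lambda>s\<in>S. (\<lambda>t\<in>T. v (\<sigma> t)) (\<tau> s)) = v"
      by (auto simp: direct_sum_simps \<tau> fun_eq_iff PiE_def extensional_def)
    show "\<forall>w\<in>carrier (part (direct_sum T N) i). (\<lambda>t\<in>T. (\<lambda>s\<in>S. w (\<tau> s)) (\<sigma> t)) = w"
      by (auto simp: direct_sum_simps \<tau>' fun_eq_iff PiE_def extensional_def)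
    show "(\<lambda>v. \<lambda>t\<in>T. v (\<sigma> t)) ` carrier (part (direct_sum S M) i)
        \<subseteq> carrier (part (direct_sum T N) i)"
    proof (intro image_subsetI)
      fix v assume "v \<in> carrier (part (direct_sum S M) i)"
      then have v: "v \<in> (\<Pi>\<^sub>E s\<in>S. carrier (part (M s) i))"
        and fin: "finite {s \<in> S. v s \<noteq> \<zero>\<^bsub>part (M s) i\<^esub>}"
        by (simp_all add: direct_sum_simps)
      have *: "(\<lambda>t\<in>T. v (\<sigma> t)) \<in> (\<Pi>\<^sub>E t\<in>T. carrier (part (N t) i))"
        using v by (auto simp: N \<tau>')
      have "{t \<in> T. (\<lambda>t\<in>T. v (\<sigma> t)) t \<noteq> \<zero>\<^bsub>part (N t) i\<^esub>} \<subseteq> \<tau> ` {s \<in> S. v s \<noteq> \<zero>\<^bsub>part (M s) i\<^esub>}"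
      proof
        fix t assume "t \<in> {t \<in> T. (\<lambda>t\<in>T. v (\<sigma> t)) t \<noteq> \<zero>\<^bsub>part (N t) i\<^esub>}"
        then show "t \<in> \<tau> ` {s \<in> S. v s \<noteq> \<zero>\<^bsub>part (M s) i\<^esub>}"
          by (intro rev_image_eqI[of "\<sigma> t"]) (auto simp: \<tau>' N)
      qed
      from finite_surj[OF fin this] * show "(\<lambda>t\<in>T. v (\<sigma> t)) \<in> carrier (part (direct_sum T N) i)"
        unfolding direct_sum_simps by blast
    qed
    show "(\<lambda>w. \<lambda>s\<in>S. w (\<tau> s)) ` carrier (part (direct_sum T N) i)
        \<subseteq> carrier (part (direct_sum S M) i)"
    proof (intro image_subsetI)
      fix w assume "w \<in> carrier (part (direct_sum T N) i)"
      then have w: "w \<in> (\<Pi>\<^sub>E t\<in>T. carrier (part (N t) i))"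
        and fin: "finite {t \<in> T. w t \<noteq> \<zero>\<^bsub>part (N t) i\<^esub>}"
        by (simp_all add: direct_sum_simps)
      have "w (\<tau> s) \<in> carrier (part (M s) i)" if "s \<in> S" for s
        using PiE_mem[OF w \<tau>(1)[OF that]] N[OF \<tau>(1)[OF that]] \<tau>(2)[OF that] by simp
      then have *: "(\<lambda>s\<in>S. w (\<tau> s)) \<in> (\<Pi>\<^sub>E s\<in>S. carrier (part (M s) i))"
        by simp
      have "{s \<in> S. (\<lambda>s\<in>S. w (\<tau> s)) s \<noteq> \<zero>\<^bsub>part (M s) i\<^esub>} \<subseteq> \<sigma> ` {t \<in> T. w t \<noteq> \<zero>\<^bsub>part (N t) i\<^esub>}"
      proof
        fix s assume "s \<in> {s \<in> S. (\<lambda>s\<in>S. w (\<tau> s)) s \<noteq> \<zero>\<^bsub>part (M s) i\<^esub>}"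
        then show "s \<in> \<sigma> ` {t \<in> T. w t \<noteq> \<zero>\<^bsub>part (N t) i\<^esub>}"
          by (intro rev_image_eqI[of "\<tau> s"]) (auto simp: \<tau> N)
      qed
      from finite_surj[OF fin this] * show "(\<lambda>s\<in>S. w (\<tau> s)) \<in> carrier (part (direct_sum S M) i)"
        unfolding direct_sum_simps by blast
    qed
  qed
  then show ?thesis
    unfolding isomorphic_def
    by (intro exI[of _ "\<lambda>i v. \<lambda>t\<in>T. v (\<sigma> t)"])
      (auto simp: direct_sum_simps N \<tau>' intro!: restrict_ext)
qed

context graded_module
begin

text \<open>
  If the relations are monomial, then two combinations agree in degree \<open>i\<close> iff their
  coefficients agree at the generators that survive in degree \<open>i\<close>. So these coefficients are
  well defined, and they identify the submodule with the direct sum. The hypothesis \<open>rel\<close>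
  speaks of the ambient module, in which zero and sums are the same as in the submodule.
\<close>

lemma isomorphic_generated_submodule:
  assumes m: "\<forall>s\<in>S. m s \<in> carrier (part M (p s))"
    and rel: "\<And>i. {c \<in> free_part S p i. evaluate M p m i c = \<zero>\<^bsub>part M i\<^esub>} = relation_part S q i"
  shows "isomorphic (generated_submodule M S p m)
    (direct_sum S (\<lambda>s. interval_module (survival (p s) (q s))))"
proof -
  define K where "K i = {s \<in> S. i \<in> survival (p s) (q s)}" for i
  \<comment> \<open>Any coefficients representing \<open>v\<close> will do, as \<open>eq\<close> below shows.\<close>
  define \<phi> where "\<phi> i v = (\<lambda>s\<in>S. if s \<in> K i
    then (SOME c. c \<in> free_part S p i \<and> evaluate M p m i c = v) s else 0)" for i v
  have eq: "evaluate M p m i c = evaluate M p m i d \<longleftrightarrow> (\<forall>s\<in>K i. c s = d s)"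
    if c: "c \<in> free_part S p i" and d: "d \<in> free_part S p i" for i c d
  proof -
    have e: "(\<lambda>s. c s - d s) \<in> free_part S p i"
      using free_part_add[OF c free_part_scale[OF d, of "- 1"]] by simp
    have "evaluate M p m i c = evaluate M p m i d
        \<longleftrightarrow> (\<lambda>s. c s - d s) \<in> relation_part S q i"
      using evaluate_eq_iff[OF m c d] rel[of i] e by blast
    also have "\<dots> \<longleftrightarrow> (\<forall>s\<in>K i. c s = d s)"
      using e by (auto simp: free_part_def relation_part_def K_def survival_def)
    finally show ?thesis .
  qed
  have \<phi>: "\<phi> i (evaluate M p m i c) = (\<lambda>s\<in>S. if s \<in> K i then c s else 0)"
    if c: "c \<in> free_part S p i" for i c
  proof -
    let ?d = "SOME d. d \<in> free_part S p i \<and> evaluate M p m i d = evaluate M p m i c"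
    have d: "?d \<in> free_part S p i" "evaluate M p m i ?d = evaluate M p m i c"
      using someI[of "\<lambda>d. d \<in> free_part S p i \<and> evaluate M p m i d = evaluate M p m i c" c] c
      by auto
    then have "\<forall>s\<in>K i. ?d s = c s"
      using eq[OF d(1) c] by blast
    then show ?thesis
      unfolding \<phi>_def by (intro restrict_ext) simp
  qed
  let ?D = "direct_sum S (\<lambda>s. interval_module (survival (p s) (q s))) :: ('g, 'f, _) persistence_module"
  have D: "carrier (part ?D i) = {v \<in> \<Pi>\<^sub>E s\<in>S. if s \<in> K i then UNIV else {0}. finite {s \<in> S. v s \<noteq> 0}}" for i
    by (auto simp: direct_sum_simps interval_module_simps K_def PiE_iff)
  have bij: "bij_betw (\<phi> i) (evaluate M p m i ` free_part S p i) (carrier (part ?D i))" for i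
    unfolding bij_betw_def
  proof
    show "inj_on (\<phi> i) (evaluate M p m i ` free_part S p i)"
    proof (intro inj_onI, elim imageE, hypsubst)
      fix c d assume c: "c \<in> free_part S p i" and d: "d \<in> free_part S p i"
        and "\<phi> i (evaluate M p m i c) = \<phi> i (evaluate M p m i d)"
      then have "\<forall>s\<in>S. (if s \<in> K i then c s else 0) = (if s \<in> K i then d s else 0)"
        by (simp add: \<phi> fun_eq_iff restrict_def) metis
      then show "evaluate M p m i c = evaluate M p m i d"
        unfolding eq[OF c d] by (auto simp: K_def split: if_splits)
    qed
    show "\<phi> i ` (evaluate M p m i ` free_part S p i) = carrier (part ?D i)"
    proof (intro equalityI subsetI)
      fix w assume "w \<in> \<phi> i ` (evaluate M p m i ` free_part S p i)"
      then obtain c where c: "c \<in> free_part S p i" and w: "w = (\<lambda>s\<in>S. if s \<in> K i then c s else 0)"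
        by (auto simp: \<phi>)
      have "finite {s. c s \<noteq> 0}"
        using c by (simp add: free_part_def)
      then show "w \<in> carrier (part ?D i)"
        unfolding D w by (auto intro: finite_subset[of _ "{s. c s \<noteq> 0}"] split: if_splits)
    next
      fix w assume w: "w \<in> carrier (part ?D i)"
      define c where "c s = (if s \<in> S then w s else 0)" for s
      have off: "w s = 0" if "s \<in> S" "s \<notin> K i" for s
        using w that by (auto simp: D PiE_iff)
      have supp: "{s. c s \<noteq> 0} = {s \<in> S. w s \<noteq> 0}"
        by (auto simp: c_def)
      have "finite {s. c s \<noteq> 0}"
        unfolding supp using w by (simp add: D)
      then have c: "c \<in> free_part S p i"
        using off unfolding free_part_def by (auto simp: supp K_def survival_def)
      have "(\<lambda>s\<in>S. if s \<in> K i then c s else 0) = w"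
        using w off by (auto simp: D c_def fun_eq_iff PiE_iff extensional_def)
      then have "w = \<phi> i (evaluate M p m i c)"
        by (simp add: \<phi>[OF c])
      then show "w \<in> \<phi> i ` (evaluate M p m i ` free_part S p i)"
        using c by blast
    qed
  qed
  have G: "part (generated_submodule M S p m) i = (part M i)\<lparr>carrier := evaluate M p m i ` free_part S p i\<rparr>"
      "shift (generated_submodule M S p m) = shift M" for i
    by (simp_all add: generated_submodule_def)
  show ?thesis
    unfolding isomorphic_def
  proof (rule exI[of _ \<phi>], intro conjI allI impI ballI)
    show "bij_betw (\<phi> i) (carrier (part (generated_submodule M S p m) i)) (carrier (part ?D i))" for i
      using bij by (simp add: G)
  next
    fix i v w assume "v \<in> carrier (part (generated_submodule M S p m) i)"
      and "w \<in> carrier (part (generated_submodule M S p m) i)"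
    then obtain c d where c: "c \<in> free_part S p i" "v = evaluate M p m i c"
      and d: "d \<in> free_part S p i" "w = evaluate M p m i d"
      by (auto simp: G)
    then show "\<phi> i (v \<oplus>\<^bsub>part (generated_submodule M S p m) i\<^esub> w) = \<phi> i v \<oplus>\<^bsub>part ?D i\<^esub> \<phi> i w"
      by (auto simp: G evaluate_add[OF m c(1) d(1), symmetric] \<phi> free_part_add
          direct_sum_simps interval_module_simps intro!: restrict_ext)
  next
    fix i a v assume "v \<in> carrier (part (generated_submodule M S p m) i)"
    then obtain c where c: "c \<in> free_part S p i" "v = evaluate M p m i c"
      by (auto simp: G)
    then show "\<phi> i (a \<odot>\<^bsub>part (generated_submodule M S p m) i\<^esub> v) = a \<odot>\<^bsub>part ?D i\<^esub> \<phi> i v"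
      by (auto simp: G evaluate_smult[OF m c(1), symmetric] \<phi> free_part_scale
          direct_sum_simps interval_module_simps intro!: restrict_ext)
  next
    fix i j v assume ij: "i \<le> j" and "v \<in> carrier (part (generated_submodule M S p m) i)"
    then obtain c where c: "c \<in> free_part S p i" "v = evaluate M p m i c"
      by (auto simp: G)
    have "c s = 0" if "j \<in> survival (p s) (q s)" "i \<notin> survival (p s) (q s)" for s
      using that c(1) ij unfolding survival_def free_part_def by (blast intro: order_trans)
    then show "\<phi> j (shift (generated_submodule M S p m) i j v) = shift ?D i j (\<phi> i v)"
      by (auto simp: G c(2) shift_evaluate[OF m c(1) ij] \<phi>[OF c(1)] \<phi>[OF free_part_mono[OF c(1) ij]]
          direct_sum_simps interval_module_simps K_def intro!: restrict_ext)
  qed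
qed

lemma presented_imp_isomorphic:
  assumes "presented_by M S p q m"
  shows "isomorphic M (direct_sum S (\<lambda>s. interval_module (survival (p s) (q s))))"
proof -
  have "generated_submodule M S p m = M"
    using assms by (simp add: generated_submodule_def presented_by_def)
  moreover have "\<forall>s\<in>S. m s \<in> carrier (part M (p s))"
    "\<And>i. {c \<in> free_part S p i. evaluate M p m i c = \<zero>\<^bsub>part M i\<^esub>} = relation_part S q i"
    using assms unfolding presented_by_def by blast+
  ultimately show ?thesis
    using isomorphic_generated_submodule[of S m p q] by simp
qed

text \<open>
  The preimages of the unit vectors generate \<open>M\<close> with monomial relations. The larger index
  set \<open>T\<close> allows for additional generators that die at birth, such as points of a persistence
  diagram that lie on the diagonal; they are sent to zero.
\<close>

lemma isomorphic_imp_presented: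
  assumes iso: "isomorphic M (direct_sum S (\<lambda>s. interval_module (survival (p s) (q s))))"
    and "S \<subseteq> T"
    and le: "\<And>t d. \<lbrakk>t \<in> T; q t = Some d\<rbrakk> \<Longrightarrow> p t \<le> d"
    and extra: "\<And>t. t \<in> T - S \<Longrightarrow> q t = Some (p t)"
  shows "\<exists>m. presented_by M T p q m"
proof -
  let ?I = "\<lambda>s. survival (p s) (q s)"
  let ?D = "direct_sum S (\<lambda>s. interval_module (?I s)) :: ('g, 'f, _) persistence_module"
  obtain \<phi> where bij: "\<And>i. bij_betw (\<phi> i) (carrier (part M i)) (carrier (part ?D i))"
    and add: "\<And>i v w. \<lbrakk>v \<in> carrier (part M i); w \<in> carrier (part M i)\<rbrakk> \<Longrightarrow>
       \<phi> i (v \<oplus>\<^bsub>part M i\<^esub> w) = \<phi> i v \<oplus>\<^bsub>part ?D i\<^esub> \<phi> i w"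
    and smult: "\<And>i a v. v \<in> carrier (part M i) \<Longrightarrow> \<phi> i (a \<odot>\<^bsub>part M i\<^esub> v) = a \<odot>\<^bsub>part ?D i\<^esub> \<phi> i v"
    and shift: "\<And>i j v. \<lbrakk>i \<le> j; v \<in> carrier (part M i)\<rbrakk> \<Longrightarrow> \<phi> j (shift M i j v) = shift ?D i j (\<phi> i v)"
    by (rule isomorphicE[OF iso]) (rule that)
  \<comment> \<open>The unit vector of \<open>t\<close> in degree \<open>p t\<close>; it is zero when \<open>t\<close> does not survive its own
    birth, in particular for \<open>t \<notin> S\<close>.\<close>
  define u where "u t = (\<lambda>s\<in>S. if s = t \<and> p t \<in> ?I t then 1 else 0 :: 'f)" for t
  have "u t \<in> carrier (part ?D (p t))" for t
    by (auto simp: u_def direct_sum_simps interval_module_simps intro: finite_subset[of _ "{t}"])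
  then have "\<exists>v. v \<in> carrier (part M (p t)) \<and> \<phi> (p t) v = u t" for t
    using bij[of "p t"] unfolding bij_betw_def by (metis imageE)
  then obtain m where m: "\<And>t. m t \<in> carrier (part M (p t))" and \<phi>m: "\<And>t. \<phi> (p t) (m t) = u t"
    by metis
  have mT: "\<forall>t\<in>T. m t \<in> carrier (part M (p t))"
    using m by blast
  have coord: "\<phi> i (evaluate M p m i c) = (\<lambda>s\<in>S. if i \<in> ?I s then c s else 0)"
    if c: "c \<in> free_part T p i" for i c
  proof
    fix s
    have mem: "\<phi> i (evaluate M p m i c) \<in> carrier (part ?D i)"
      using bij_betwE[OF bij] evaluate_closed[OF mT c] by blast
    show "\<phi> i (evaluate M p m i c) s = (\<lambda>s\<in>S. if i \<in> ?I s then c s else 0) s"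
    proof (cases "s \<in> S")
      case True
      have fin: "finite {t. c t \<noteq> 0}"
        using c by (simp add: free_part_def)
      have "\<phi> i (evaluate M p m i c) s
          = (\<Sum>t | c t \<noteq> 0. \<phi> i (c t \<odot>\<^bsub>part M i\<^esub> shift M (p t) i (m t)) s)"
        unfolding evaluate_def
        by (rule finsum_coordinate[OF amonoid fin term_closed[OF mT c]])
          (simp add: add direct_sum_simps interval_module_simps True)
      also have "\<dots> = (\<Sum>t | c t \<noteq> 0. if t = s then (if i \<in> ?I s then c s else 0) else 0)"
      proof (rule sum.cong[OF refl])
        fix t assume "t \<in> {t. c t \<noteq> 0}"
        then have t: "t \<in> T" "p t \<le> i"
          using c by (auto simp: free_part_def)
        have "p t \<in> ?I t" if "i \<in> ?I t"
          using that t(2) by (auto simp: survival_def intro: order_trans)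
        then show "\<phi> i (c t \<odot>\<^bsub>part M i\<^esub> shift M (p t) i (m t)) s
            = (if t = s then (if i \<in> ?I s then c s else 0) else 0)"
          using t True
          by (auto simp: smult shift m shift_closed \<phi>m u_def direct_sum_simps interval_module_simps)
      qed
      also have "\<dots> = (if i \<in> ?I s then c s else 0)"
        using fin by (simp add: sum.delta)
      finally show ?thesis
        using True by simp
    next
      case False
      then show ?thesis
        using mem by (auto simp: direct_sum_simps PiE_iff extensional_def)
    qed
  qed
  have inj: "inj_on (\<phi> i) (carrier (part M i))" for i
    using bij by (auto simp: bij_betw_def)
  have surj: "evaluate M p m i ` free_part T p i = carrier (part M i)" for i
  proof
    show "evaluate M p m i ` free_part T p i \<subseteq> carrier (part M i)"
      using evaluate_closed[OF mT] by blast
    show "carrier (part M i) \<subseteq> evaluate M p m i ` free_part T p i"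
    proof
      fix v assume v: "v \<in> carrier (part M i)"
      define c where "c s = (if s \<in> S then \<phi> i v s else 0)" for s
      have \<phi>v: "\<phi> i v \<in> carrier (part ?D i)"
        using v bij_betwE[OF bij] by blast
      have off: "\<phi> i v s = 0" if "s \<in> S" "i \<notin> ?I s" for s
        using \<phi>v that by (auto simp: direct_sum_simps interval_module_simps PiE_iff)
      have supp: "{s. c s \<noteq> 0} = {s \<in> S. \<phi> i v s \<noteq> 0}"
        by (auto simp: c_def)
      have "finite {s. c s \<noteq> 0}"
        unfolding supp using \<phi>v by (simp add: direct_sum_simps interval_module_simps)
      then have c: "c \<in> free_part T p i"
        using off \<open>S \<subseteq> T\<close> unfolding free_part_def by (auto simp: supp survival_def)
      have "\<phi> i (evaluate M p m i c) = \<phi> i v"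
        using \<phi>v off by (auto simp: coord[OF c] c_def fun_eq_iff direct_sum_simps PiE_iff extensional_def)
      then have "evaluate M p m i c = v"
        using inj_onD[OF inj] evaluate_closed[OF mT c] v by blast
      then show "v \<in> evaluate M p m i ` free_part T p i"
        using c by blast
    qed
  qed
  have zero: "\<phi> i \<zero>\<^bsub>part M i\<^esub> = (\<lambda>s\<in>S. 0)" for i
    using smult[OF zero_closed, of i 0]
    by (simp add: zero_smult zero_closed direct_sum_simps interval_module_simps)
  have "{c \<in> free_part T p i. evaluate M p m i c = \<zero>\<^bsub>part M i\<^esub>} = relation_part T q i" for i
  proof -
    have free: "c \<in> free_part T p i" if "c \<in> relation_part T q i" for c :: "_ \<Rightarrow> 'f"
      using that le unfolding relation_part_def free_part_def by (blast intro: order_trans)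
    have "evaluate M p m i c = \<zero>\<^bsub>part M i\<^esub> \<longleftrightarrow> c \<in> relation_part T q i"
      if c: "c \<in> free_part T p i" for c
    proof -
      have "evaluate M p m i c = \<zero>\<^bsub>part M i\<^esub> \<longleftrightarrow> (\<lambda>s\<in>S. if i \<in> ?I s then c s else 0) = (\<lambda>s\<in>S. 0)"
        using inj_on_eq_iff[OF inj evaluate_closed[OF mT c] zero_closed] by (simp add: coord[OF c] zero)
      also have "\<dots> \<longleftrightarrow> (\<forall>s\<in>S. i \<in> ?I s \<longrightarrow> c s = 0)"
        by (auto simp: fun_eq_iff restrict_def)
      also have "\<dots> \<longleftrightarrow> (\<forall>s\<in>T. i \<in> ?I s \<longrightarrow> c s = 0)"
      proof -
        have "s \<in> S" if "s \<in> T" "i \<in> ?I s" for s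
          using extra[of s] that by (auto simp: survival_def)
        then show ?thesis
          using \<open>S \<subseteq> T\<close> by blast
      qed
      also have "\<dots> \<longleftrightarrow> c \<in> relation_part T q i"
        using c by (auto simp: free_part_def relation_part_def survival_def)
      finally show ?thesis .
    qed
    then show ?thesis
      using free by blast
  qed
  then show ?thesis
    unfolding presented_by_def using mT surj by blast
qed

end

section \<open>Homology of sublevel sets as a graded module\<close>

abbreviation chain_scale :: "'f::field \<Rightarrow> ('a, 'f) field_chain \<Rightarrow> ('a, 'f) field_chain" where
  "chain_scale r \<equiv> Poly_Mapping.map ((*) r)"

lemma lookup_chain_scale [simp]:
  "Poly_Mapping.lookup (chain_scale r c) x = r * Poly_Mapping.lookup c x"
  by (simp add: Poly_Mapping.map.rep_eq when_def)

interpretation chains: vector_space "chain_scale :: 'f::field \<Rightarrow> ('a, 'f) field_chain \<Rightarrow> _"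
  by unfold_locales (auto intro!: poly_mapping_eqI simp: lookup_add algebra_simps)

lemma chain_scale_single: "chain_scale r (Poly_Mapping.single x a) = Poly_Mapping.single x (r * a)"
  by (rule poly_mapping_eqI) (simp add: lookup_single when_def)

text \<open>
  The boundary of \<open>a \<sigma>\<close> for a single simplex \<open>\<sigma>\<close> and a scalar \<open>a\<close>, in positive degree \<open>k\<close>.
\<close>

definition boundary_term :: "nat \<Rightarrow> ((nat \<Rightarrow> real) \<Rightarrow> 'a) \<Rightarrow> 'f::field \<Rightarrow> ('a, 'f) field_chain" where
  "boundary_term k \<sigma> a = (\<Sum>i\<le>k. Poly_Mapping.single (singular_face k i \<sigma>) ((-1) ^ i * a))"

lemma boundary_term_simps:
  "boundary_term k \<sigma> (a + b) = boundary_term k \<sigma> a + boundary_term k \<sigma> b"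
  "boundary_term k \<sigma> 0 = 0"
  "boundary_term k \<sigma> (r * a) = chain_scale r (boundary_term k \<sigma> a)"
  by (simp_all add: boundary_term_def distrib_left single_add sum.distrib chains.scale_sum_right
      chain_scale_single mult.left_commute)

text \<open>
  As for \<open>evaluate\<close>, padding the support is what makes additivity of the boundary visible.
\<close>

lemma field_boundary_superset:
  assumes "finite A" and "Poly_Mapping.keys c \<subseteq> A"
  shows "field_boundary k c
    = (if k = 0 then 0 else \<Sum>\<sigma>\<in>A. boundary_term k \<sigma> (Poly_Mapping.lookup c \<sigma>))"
proof -
  have "(\<Sum>\<sigma>\<in>Poly_Mapping.keys c. boundary_term k \<sigma> (Poly_Mapping.lookup c \<sigma>))
      = (\<Sum>\<sigma>\<in>A. boundary_term k \<sigma> (Poly_Mapping.lookup c \<sigma>))"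
    by (rule sum.mono_neutral_left) (use assms in \<open>auto simp: in_keys_iff boundary_term_simps\<close>)
  then show ?thesis
    by (simp add: field_boundary_def boundary_term_def)
qed

lemma linear_field_boundary:
  "Vector_Spaces.linear chain_scale chain_scale
    (field_boundary k :: ('a, 'f::field) field_chain \<Rightarrow> ('a, 'f) field_chain)"
proof (unfold_locales, goal_cases)
  case (1 c d)
  let ?A = "Poly_Mapping.keys c \<union> Poly_Mapping.keys d"
  have "field_boundary k e
      = (if k = 0 then 0 else \<Sum>\<sigma>\<in>?A. boundary_term k \<sigma> (Poly_Mapping.lookup e \<sigma>))"
    if "e \<in> {c, d, c + d}" for e
    using that Poly_Mapping.keys_add[of c d] by (intro field_boundary_superset) auto
  then show ?case
    by (simp add: lookup_add boundary_term_simps sum.distrib)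
next
  case (2 r c)
  have "Poly_Mapping.keys (chain_scale r c) \<subseteq> Poly_Mapping.keys c"
    by (auto simp: in_keys_iff)
  then show ?case
    by (simp add: field_boundary_superset[of "Poly_Mapping.keys c"] boundary_term_simps
        chains.scale_sum_right)
qed

interpretation boundary: Vector_Spaces.linear chain_scale chain_scale
    "field_boundary k :: ('a, 'f::field) field_chain \<Rightarrow> ('a, 'f) field_chain" for k
  by (rule linear_field_boundary)

lemma subspace_field_chains:
  "chains.subspace (field_chains k X :: ('a, 'f::field) field_chain set)"
proof (rule chains.subspaceI)
  fix c d :: "('a, 'f) field_chain"
  assume "c \<in> field_chains k X" "d \<in> field_chains k X"
  then show "c + d \<in> field_chains k X"
    using Poly_Mapping.keys_add[of c d] unfolding field_chains_def by blast
qed (auto simp: field_chains_def in_keys_iff)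

lemma subspace_field_cycles:
  "chains.subspace (field_cycles k X :: ('a, 'f::field) field_chain set)"
proof -
  have "(field_cycles k X :: ('a, 'f) field_chain set)
      = field_chains k X \<inter> {c. field_boundary k c = 0}"
    by (auto simp: field_cycles_def)
  then show ?thesis
    using chains.subspace_inter[OF subspace_field_chains boundary.subspace_kernel] by simp
qed

lemma subspace_field_boundaries: "chains.subspace (field_boundaries k X)"
  unfolding field_boundaries_def by (rule boundary.subspace_image[OF subspace_field_chains])

lemma cycles_and_boundaries_mono:
  assumes "A \<subseteq> B"
  shows "field_cycles k (subtopology X A) \<subseteq> field_cycles k (subtopology X B)"
    and "field_boundaries k (subtopology X A) \<subseteq> field_boundaries k (subtopology X B)"
  using singular_simplex_mono[OF _ assms]
  by (force simp: field_cycles_def field_boundaries_def field_chains_def)+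

text \<open>
  Homology classes are cosets of the boundaries. The next three lemmas say that the set
  operations in the definition of homology act on representatives; they hold for cosets of any
  subspace.
\<close>

definition coset :: "('a, 'f::field) field_chain set \<Rightarrow> ('a, 'f) field_chain \<Rightarrow> ('a, 'f) field_chain set" where
  "coset B z = {z + b |b. b \<in> B}"

lemma coset_add:
  assumes "chains.subspace B"
  shows "{a + c |a c. a \<in> coset B y \<and> c \<in> coset B z} = coset B (y + z)"
proof (intro equalityI subsetI)
  fix x assume "x \<in> {a + c |a c. a \<in> coset B y \<and> c \<in> coset B z}"
  then obtain b b' where "x = (y + z) + (b + b')" "b \<in> B" "b' \<in> B"
    by (auto simp: coset_def algebra_simps)
  then show "x \<in> coset B (y + z)"
    using chains.subspace_add[OF assms] by (auto simp: coset_def)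
next
  fix x assume "x \<in> coset B (y + z)"
  then obtain b where "x = (y + b) + (z + 0)" "b \<in> B"
    by (auto simp: coset_def algebra_simps)
  then show "x \<in> {a + c |a c. a \<in> coset B y \<and> c \<in> coset B z}"
    using chains.subspace_0[OF assms] unfolding coset_def by blast
qed

lemma coset_scale:
  assumes "chains.subspace B"
  shows "{chain_scale r a + b |a b. a \<in> coset B z \<and> b \<in> B} = coset B (chain_scale r z)"
proof (intro equalityI subsetI)
  fix x assume "x \<in> {chain_scale r a + b |a b. a \<in> coset B z \<and> b \<in> B}"
  then obtain b b' where "x = chain_scale r z + (chain_scale r b + b')" "b \<in> B" "b' \<in> B"
    by (auto simp: coset_def algebra_simps chains.scale_right_distrib)
  then show "x \<in> coset B (chain_scale r z)"
    using chains.subspace_add[OF assms] chains.subspace_scale[OF assms] by (auto simp: coset_def)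
next
  fix x assume "x \<in> coset B (chain_scale r z)"
  then obtain b where "x = chain_scale r (z + 0) + b" "b \<in> B"
    by (auto simp: coset_def)
  then show "x \<in> {chain_scale r a + b |a b. a \<in> coset B z \<and> b \<in> B}"
    using chains.subspace_0[OF assms] unfolding coset_def by blast
qed

lemma coset_absorb:
  assumes "chains.subspace B" "A \<subseteq> B" "0 \<in> A"
  shows "{a + b |a b. a \<in> coset A z \<and> b \<in> B} = coset B z"
proof (intro equalityI subsetI)
  fix x assume "x \<in> {a + b |a b. a \<in> coset A z \<and> b \<in> B}"
  then obtain b b' where "x = z + (b + b')" "b \<in> B" "b' \<in> B"
    using assms(2) by (auto simp: coset_def algebra_simps)
  then show "x \<in> coset B z"
    using chains.subspace_add[OF assms(1)] by (auto simp: coset_def)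
next
  fix x assume "x \<in> coset B z"
  then obtain b where "x = (z + 0) + b" "b \<in> B"
    by (auto simp: coset_def)
  then show "x \<in> {a + b |a b. a \<in> coset A z \<and> b \<in> B}"
    using assms(3) unfolding coset_def by blast
qed

lemma field_homology_simps:
  shows "carrier (field_homology k X) = coset (field_boundaries k X) ` field_cycles k X"
    and "\<zero>\<^bsub>field_homology k X\<^esub> = coset (field_boundaries k X) 0"
    and "coset (field_boundaries k X) y \<oplus>\<^bsub>field_homology k X\<^esub> coset (field_boundaries k X) z
      = coset (field_boundaries k X) (y + z)"
    and "r \<odot>\<^bsub>field_homology k X\<^esub> coset (field_boundaries k X) z
      = coset (field_boundaries k X) (chain_scale r z)"
  using coset_add[OF subspace_field_boundaries, of k X y z]
    coset_scale[OF subspace_field_boundaries, of r k X z]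
  by (auto simp: field_homology_def coset_def[abs_def])

text \<open>
  The operations of homology classes are operations on representing cycles, so the module
  axioms are inherited from the space of chains.
\<close>

lemma module_field_homology: "Module.module field_ring (field_homology k X)"
proof (rule moduleI[OF cring_field_ring])
  note closed = chains.subspace_add[OF subspace_field_cycles]
    chains.subspace_scale[OF subspace_field_cycles] chains.subspace_0[OF subspace_field_cycles]
  show "abelian_group (field_homology k X)"
  proof (rule abelian_groupI, goal_cases)
    case (6 x)
    then obtain z where z: "z \<in> field_cycles k X" "x = coset (field_boundaries k X) z"
      by (auto simp: field_homology_simps)
    then show ?case
      using chains.subspace_neg[OF subspace_field_cycles z(1)]
      by (intro bexI[of _ "coset (field_boundaries k X) (- z)"]) (auto simp: field_homology_simps)
  qed (auto simp: field_homology_simps closed ac_simps)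
  show "(a \<otimes>\<^bsub>field_ring\<^esub> b) \<odot>\<^bsub>field_homology k X\<^esub> x
      = a \<odot>\<^bsub>field_homology k X\<^esub> (b \<odot>\<^bsub>field_homology k X\<^esub> x)"
    if "x \<in> carrier (field_homology k X)" for a b x
    using that by (auto simp: field_homology_simps)
qed (auto simp: field_homology_simps chains.subspace_scale[OF subspace_field_cycles]
    chains.scale_left_distrib chains.scale_right_distrib)

lemma graded_module_sublevel_homology: "graded_module (sublevel_homology k X h)"
proof -
  let ?B = "\<lambda>i. field_boundaries k (sublevel X h i)"
  let ?Z = "\<lambda>i. field_cycles k (sublevel X h i)"
  have mono: "?Z i \<subseteq> ?Z j" "?B i \<subseteq> ?B j" if "i \<le> j" for i j
    unfolding sublevel_def
    by (rule cycles_and_boundaries_mono; use that in \<open>auto intro: order_trans\<close>)+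
  have part: "part (sublevel_homology k X h) i = field_homology k (sublevel X h i)" for i
    by (simp add: sublevel_homology_def)
  have shift: "shift (sublevel_homology k X h) i j (coset (?B i) z) = coset (?B j) z"
    if "i \<le> j" for i j z
    using coset_absorb[OF subspace_field_boundaries mono(2)[OF that]
        chains.subspace_0[OF subspace_field_boundaries]]
    by (simp add: sublevel_homology_def)
  show ?thesis
  proof (rule graded_module.intro)
    show "Module.module field_ring (part (sublevel_homology k X h) i)" for i
      unfolding part by (rule module_field_homology)
  qed (auto simp: part field_homology_simps shift subsetD[OF mono(1)]
      intro: order_trans)
qed

section \<open>Finitely generated modules over the polynomial ring are sums of intervals\<close>

context graded_module
begin

lemma evaluate_cong:
  assumes m: "\<forall>s\<in>S. m s \<in> carrier (part M (p s))" and c: "c \<in> free_part S p i"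
    and "\<And>s. c s \<noteq> 0 \<Longrightarrow> m' s = m s"
  shows "evaluate M p m' i c = evaluate M p m i c"
  unfolding evaluate_def
  by (rule abelian_monoid.finsum_cong'[OF amonoid refl term_closed[OF m c]]) (use assms(3) in auto)

lemma evaluate_upd:
  assumes m: "\<forall>s\<in>S. m s \<in> carrier (part M (p s))" and c: "c \<in> free_part S p i"
    and t: "t \<in> S" "p t \<le> i" "c t = 0"
  shows "evaluate M p m i (c(t := a))
    = a \<odot>\<^bsub>part M i\<^esub> shift M (p t) i (m t) \<oplus>\<^bsub>part M i\<^esub> evaluate M p m i c"
proof -
  let ?A = "{s. c s \<noteq> 0}"
  have A: "finite ?A" "?A \<subseteq> {s \<in> S. p s \<le> i}" "t \<notin> ?A"
    using c t by (auto simp: free_part_def)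
  have cl: "b \<odot>\<^bsub>part M i\<^esub> shift M (p s) i (m s) \<in> carrier (part M i)" if "s \<in> insert t ?A" for b s
    using A m t that by (auto intro!: shift_closed smult_closed)
  have "evaluate M p m i (c(t := a))
      = (\<Oplus>\<^bsub>part M i\<^esub> s \<in> insert t ?A. (c(t := a)) s \<odot>\<^bsub>part M i\<^esub> shift M (p s) i (m s))"
    by (rule evaluate_superset[OF m]) (use A t in \<open>auto split: if_splits\<close>)
  also have "\<dots> = a \<odot>\<^bsub>part M i\<^esub> shift M (p t) i (m t) \<oplus>\<^bsub>part M i\<^esub>
      (\<Oplus>\<^bsub>part M i\<^esub> s \<in> ?A. (c(t := a)) s \<odot>\<^bsub>part M i\<^esub> shift M (p s) i (m s))"
    by (subst abelian_monoid.finsum_insert[OF amonoid A(1,3)]) (use cl in auto)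
  also have "(\<Oplus>\<^bsub>part M i\<^esub> s \<in> ?A. (c(t := a)) s \<odot>\<^bsub>part M i\<^esub> shift M (p s) i (m s))
      = evaluate M p m i c"
    unfolding evaluate_def
    by (rule abelian_monoid.finsum_cong'[OF amonoid refl]) (use cl A(3) in auto)
  finally show ?thesis .
qed

text \<open>
  A generator may be replaced by any combination of generators of lower or equal degree in
  which its own coefficient is \<open>1\<close>, since it can be recovered from that combination.
\<close>

lemma generators_exchange:
  assumes m: "\<forall>s\<in>S. m s \<in> carrier (part M (p s))"
    and t: "t \<in> S" and a: "a \<in> free_part S p (p t)" "a t = 1"
  shows "evaluate M p m i ` free_part S p i
    \<subseteq> evaluate M p (m(t := evaluate M p m (p t) a)) i ` free_part S p i"
proof
  define m' where "m' = m(t := evaluate M p m (p t) a)"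
  have m't: "m' t = evaluate M p m (p t) a" and m'_other: "\<And>s. s \<noteq> t \<Longrightarrow> m' s = m s"
    by (simp_all add: m'_def)
  have m': "\<forall>s\<in>S. m' s \<in> carrier (part M (p s))"
    using m evaluate_closed[OF m a(1)] by (simp add: m'_def)
  fix v assume "v \<in> evaluate M p m i ` free_part S p i"
  then obtain c where c: "c \<in> free_part S p i" and v: "v = evaluate M p m i c"
    by blast
  have "v \<in> evaluate M p m' i ` free_part S p i"
  proof (cases "c t = 0")
    case True
    then have "evaluate M p m' i c = v"
      unfolding v by (intro evaluate_cong[OF m c] m'_other) auto
    then show ?thesis
      using c by blast
  next
    case False
    then have ti: "p t \<le> i"
      using c by (auto simp: free_part_def)
    have ai: "a \<in> free_part S p i"
      by (rule free_part_mono[OF a(1) ti])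
    \<comment> \<open>The substitution \<open>m\<^sub>t = m'\<^sub>t - (\<Sum>s\<noteq>t. a\<^sub>s m\<^sub>s)\<close> in \<open>\<Sum>s. c\<^sub>s m\<^sub>s\<close> leaves the coefficients \<open>e\<close> at
      the other generators and \<open>c t\<close> at \<open>m'\<^sub>t\<close>.\<close>
    define e where "e = (\<lambda>s. c s + (- c t) * a s)"
    have e: "e \<in> free_part S p i"
      unfolding e_def by (rule free_part_add[OF c free_part_scale[OF ai]])
    have et: "e t = 0"
      by (simp add: e_def a)
    have e': "e(t := c t) \<in> free_part S p i"
    proof -
      have "{s. (e(t := c t)) s \<noteq> 0} = insert t {s. e s \<noteq> 0}"
        using False by auto
      then show ?thesis
        using e t ti by (simp add: free_part_def)
    qed
    have "evaluate M p m' i (e(t := c t))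
        = c t \<odot>\<^bsub>part M i\<^esub> evaluate M p m i a \<oplus>\<^bsub>part M i\<^esub> evaluate M p m i e"
    proof -
      have "evaluate M p m' i e = evaluate M p m i e"
        by (intro evaluate_cong[OF m e] m'_other) (use et in auto)
      then show ?thesis
        using evaluate_upd[OF m' e t ti et, of "c t"] shift_evaluate[OF m a(1) ti]
        by (simp only: m't)
    qed
    also have "\<dots> = evaluate M p m i (\<lambda>s. c t * a s + e s)"
      using evaluate_smult[OF m ai] evaluate_add[OF m free_part_scale[OF ai] e] by simp
    also have "(\<lambda>s. c t * a s + e s) = c"
      by (simp add: e_def)
    finally have "v = evaluate M p m' i (e(t := c t))"
      unfolding v by (rule sym)
    then show ?thesis
      using e' by blast
  qed
  then show "v \<in> evaluate M p (m(t := evaluate M p m (p t) a)) i ` free_part S p i"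
    by (simp only: m'_def)
qed

text \<open>
  A generator that is killed in its own degree is zero. Such generators have to be removed
  because the intervals of a barcode are nonempty.
\<close>

lemma presented_drop_zero_generators:
  assumes pres: "presented_by M T p q m" and "S \<subseteq> T"
    and zero: "\<And>t. t \<in> T - S \<Longrightarrow> q t = Some (p t)"
  shows "presented_by M S p q m"
proof -
  have m: "\<forall>t\<in>T. m t \<in> carrier (part M (p t))"
    and gen: "\<And>i. evaluate M p m i ` free_part T p i = carrier (part M i)"
    and rel: "\<And>i. {c \<in> free_part T p i. evaluate M p m i c = \<zero>\<^bsub>part M i\<^esub>} = relation_part T q i"
    using pres unfolding presented_by_def by blast+
  have sub: "free_part S p i \<subseteq> (free_part T p i :: (_ \<Rightarrow> 'f) set)" for i
    using \<open>S \<subseteq> T\<close> by (auto simp: free_part_def)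
  have "evaluate M p m i ` free_part S p i = carrier (part M i)" for i
  proof
    show "evaluate M p m i ` free_part S p i \<subseteq> carrier (part M i)"
      using gen sub by blast
    show "carrier (part M i) \<subseteq> evaluate M p m i ` free_part S p i"
    proof
      fix v assume "v \<in> carrier (part M i)"
      then obtain c where c: "c \<in> free_part T p i" and v: "v = evaluate M p m i c"
        using gen by blast
      \<comment> \<open>The part of the combination outside \<open>S\<close> consists of relations.\<close>
      define d where "d s = (if s \<in> S then c s else 0)" for s
      define e where "e s = (if s \<in> S then 0 else c s)" for s
      have supp: "{s. d s \<noteq> 0} = {s. c s \<noteq> 0} \<inter> S" "{s. e s \<noteq> 0} = {s. c s \<noteq> 0} - S"
        by (auto simp: d_def e_def)
      have d: "d \<in> free_part S p i" and e: "e \<in> relation_part T q i"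
        using c zero unfolding free_part_def relation_part_def mem_Collect_eq supp by auto
      have e': "e \<in> free_part T p i" "evaluate M p m i e = \<zero>\<^bsub>part M i\<^esub>"
        using e rel by blast+
      have d': "d \<in> free_part T p i"
        using d sub by blast
      have "c = (\<lambda>s. d s + e s)"
        by (auto simp: d_def e_def)
      then have "v = evaluate M p m i d"
        using evaluate_add[OF m d' e'(1)] e'(2) evaluate_closed[OF m d']
        by (simp add: v abelian_monoid.r_zero[OF amonoid])
      then show "v \<in> evaluate M p m i ` free_part S p i"
        using d by blast
    qed
  qed
  moreover have "{c \<in> free_part S p i. evaluate M p m i c = \<zero>\<^bsub>part M i\<^esub>} = relation_part S q i" for i
  proof -
    have "c \<in> relation_part S q i \<longleftrightarrow> c \<in> relation_part T q i \<and> {s. c s \<noteq> 0} \<subseteq> S"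
      "c \<in> free_part S p i \<longleftrightarrow> c \<in> free_part T p i \<and> {s. c s \<noteq> 0} \<subseteq> S" for c :: "_ \<Rightarrow> 'f"
      using \<open>S \<subseteq> T\<close> by (auto simp: relation_part_def free_part_def)
    moreover have "c \<in> relation_part T q i
        \<longleftrightarrow> c \<in> free_part T p i \<and> evaluate M p m i c = \<zero>\<^bsub>part M i\<^esub>" for c
      unfolding rel[symmetric] by simp
    ultimately show ?thesis
      by auto
  qed
  ultimately show ?thesis
    using m \<open>S \<subseteq> T\<close> unfolding presented_by_def by blast
qed

end

text \<open>
  The degree in which an element \<open>v\<close> of degree \<open>b\<close> dies, \<open>None\<close> if it never does.
\<close>

definition annihilation_degree ::
    "(nat, 'f::field, 'v) persistence_module \<Rightarrow> nat \<Rightarrow> 'v \<Rightarrow> nat option" where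
  "annihilation_degree M b v =
    (if \<exists>d\<ge>b. shift M b d v = \<zero>\<^bsub>part M d\<^esub>
     then Some (LEAST d. b \<le> d \<and> shift M b d v = \<zero>\<^bsub>part M d\<^esub>) else None)"

lemma annihilation_degree_le:
  assumes M: "graded_module M" and v: "v \<in> carrier (part M b)"
  shows "(\<exists>d. annihilation_degree M b v = Some d \<and> d \<le> i)
    \<longleftrightarrow> b \<le> i \<and> shift M b i v = \<zero>\<^bsub>part M i\<^esub>"
proof
  assume "\<exists>d. annihilation_degree M b v = Some d \<and> d \<le> i"
  then obtain d where d: "\<exists>d\<ge>b. shift M b d v = \<zero>\<^bsub>part M d\<^esub>" "d \<le> i"
      "d = (LEAST d. b \<le> d \<and> shift M b d v = \<zero>\<^bsub>part M d\<^esub>)"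
    by (auto simp: annihilation_degree_def split: if_splits)
  have "b \<le> d \<and> shift M b d v = \<zero>\<^bsub>part M d\<^esub>"
    unfolding d(3) by (rule LeastI_ex) (use d(1) in blast)
  then show "b \<le> i \<and> shift M b i v = \<zero>\<^bsub>part M i\<^esub>"
    using d(2) graded_module.shift_trans[OF M _ d(2) v] graded_module.shift_zero[OF M d(2)]
    by auto
next
  assume "b \<le> i \<and> shift M b i v = \<zero>\<^bsub>part M i\<^esub>"
  then show "\<exists>d. annihilation_degree M b v = Some d \<and> d \<le> i"
    by (auto simp: annihilation_degree_def intro: Least_le)
qed

text \<open>
  The reduction step of the structure theorem. Multiples that vanish on their own are
  dropped from the relation \<open>c\<close> in degree \<open>i\<close>. Among the remaining generators, all of which
  are alive in degree \<open>i\<close>, let \<open>t\<close> have the largest degree: then the relation, normalized to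
  have coefficient \<open>1\<close> at \<open>t\<close> and divided by \<open>x\<^sup>i\<^sup>-\<^sup>p\<^sup>(\<^sup>t\<^sup>)\<close>, is a combination of degree \<open>p t\<close>. It dies
  by degree \<open>i\<close>, and so earlier than \<open>m t\<close>. The division is possible because degrees are
  totally ordered.
\<close>

lemma exchange_of_relation:
  fixes M :: "(nat, 'f::field, 'v) persistence_module"
  assumes M: "graded_module M"
    and m: "\<forall>s\<in>S. m s \<in> carrier (part M (p s))"
    and gen: "\<forall>i. evaluate M p m i ` free_part S p i = carrier (part M i)"
    and c: "c \<in> free_part S p i" "evaluate M p m i c = \<zero>\<^bsub>part M i\<^esub>"
      "c \<notin> relation_part S (\<lambda>s. annihilation_degree M (p s) (m s)) i"
  shows "\<exists>t\<in>S. \<exists>w \<in> carrier (part M (p t)).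
    (\<forall>i. evaluate M p (m(t := w)) i ` free_part S p i = carrier (part M i)) \<and>
    (\<exists>d. annihilation_degree M (p t) w = Some d \<and>
      (\<forall>e. annihilation_degree M (p t) (m t) = Some e \<longrightarrow> d < e))"
proof -
  interpret graded_module M by (rule M)
  define A where "A = {s. c s \<noteq> 0 \<and> shift M (p s) i (m s) \<noteq> \<zero>\<^bsub>part M i\<^esub>}"
  have supp: "finite {s. c s \<noteq> 0}" "{s. c s \<noteq> 0} \<subseteq> {s \<in> S. p s \<le> i}"
    using c(1) by (auto simp: free_part_def)
  have "A \<subseteq> {s. c s \<noteq> 0}"
    by (auto simp: A_def)
  then have A: "finite A" "A \<subseteq> {s \<in> S. p s \<le> i}"
    using supp finite_subset by (blast, blast)
  have "A \<noteq> {}"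
  proof
    assume "A = {}"
    then have "c s \<noteq> 0 \<Longrightarrow> \<exists>d. annihilation_degree M (p s) (m s) = Some d \<and> d \<le> i" for s
      using supp m by (subst annihilation_degree_le[OF M]) (auto simp: A_def)
    then show False
      using c(3) supp by (auto simp: relation_part_def)
  qed
  then have "Max (p ` A) \<in> p ` A"
    using A(1) by simp
  then obtain t where t: "t \<in> A" "p t = Max (p ` A)"
    by auto
  have ct: "c t \<noteq> 0" and tS: "t \<in> S" and ti: "p t \<le> i"
    using t A by (auto simp: A_def)
  \<comment> \<open>The terms of \<open>c\<close> outside \<open>A\<close> vanish in degree \<open>i\<close>, so \<open>c'\<close> is a relation as well.\<close>
  define c' where "c' s = (if s \<in> A then c s else 0)" for s
  define a where "a s = inverse (c t) * c' s" for s
  have c't: "c' \<in> free_part S p (p t)"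
    using A Max_ge[of "p ` A"] t(2)
    by (auto simp: free_part_def c'_def A_def)
  then have a: "a \<in> free_part S p (p t)"
    unfolding a_def by (rule free_part_scale)
  have at: "a t = 1"
    using t ct by (simp add: a_def c'_def)
  have c': "c' \<in> free_part S p i"
    by (rule free_part_mono[OF c't ti])
  have zero: "evaluate M p m i c' = \<zero>\<^bsub>part M i\<^esub>"
  proof -
    interpret abelian_monoid "part M i" by (rule amonoid)
    have "evaluate M p m i c'
        = (\<Oplus>\<^bsub>part M i\<^esub> s \<in> {s. c s \<noteq> 0}. c' s \<odot>\<^bsub>part M i\<^esub> shift M (p s) i (m s))"
      by (rule evaluate_superset[OF m supp(1) _ supp(2)]) (auto simp: c'_def)
    also have "\<dots> = evaluate M p m i c"
      unfolding evaluate_def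
    proof (rule finsum_cong'[OF refl term_closed[OF m c(1)]])
      fix s assume "s \<in> {s. c s \<noteq> 0}"
      then show "c' s \<odot>\<^bsub>part M i\<^esub> shift M (p s) i (m s) = c s \<odot>\<^bsub>part M i\<^esub> shift M (p s) i (m s)"
        by (auto simp: c'_def A_def zero_smult graded_module.zero_closed[OF M] smult_zero)
    qed
    finally show ?thesis
      using c(2) by simp
  qed
  define w where "w = evaluate M p m (p t) a"
  have w: "w \<in> carrier (part M (p t))"
    unfolding w_def by (rule evaluate_closed[OF m a])
  have "shift M (p t) i w = evaluate M p m i a"
    unfolding w_def by (rule shift_evaluate[OF m a ti])
  also have "\<dots> = \<zero>\<^bsub>part M i\<^esub>"
    unfolding a_def evaluate_smult[OF m c'] zero by (rule smult_zero)
  finally obtain d where d: "annihilation_degree M (p t) w = Some d" "d \<le> i"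
    using annihilation_degree_le[OF M w] ti by blast
  have "\<not> e \<le> i" if "annihilation_degree M (p t) (m t) = Some e" for e
    using annihilation_degree_le[OF M, of "m t" "p t" i] m tS t(1) that by (auto simp: A_def)
  then have less: "\<forall>e. annihilation_degree M (p t) (m t) = Some e \<longrightarrow> d < e"
    using d(2) by fastforce
  have m': "\<forall>s\<in>S. (m(t := w)) s \<in> carrier (part M (p s))"
    using m w by simp
  have "evaluate M p (m(t := w)) i ` free_part S p i = carrier (part M i)" for i
  proof
    show "evaluate M p (m(t := w)) i ` free_part S p i \<subseteq> carrier (part M i)"
      using evaluate_closed[OF m'] by blast
    show "carrier (part M i) \<subseteq> evaluate M p (m(t := w)) i ` free_part S p i"
      using generators_exchange[OF m tS a at, of i] gen unfolding w_def by simp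
  qed
  then show ?thesis
    using tS w d(1) less by blast
qed

text \<open>
  Each exchange shortens the life of one generator and leaves the others alone. So it
  decreases, lexicographically, the number of generators that never die and the sum of the
  finite annihilation degrees, and exchanging terminates.
\<close>

lemma exists_presentation:
  fixes M :: "(nat, 'f::field, 'v) persistence_module"
  assumes M: "graded_module M" and fin: "finite S"
    and m: "\<forall>s\<in>S. m s \<in> carrier (part M (p s))"
    and gen: "\<forall>i. evaluate M p m i ` free_part S p i = carrier (part M i)"
  shows "\<exists>m. presented_by M S p (\<lambda>s. annihilation_degree M (p s) (m s)) m"
proof -
  interpret graded_module M by (rule M)
  define q where "q m s = annihilation_degree M (p s) (m s)" for m s
  define immortal where "immortal m = card {s \<in> S. q m s = None}" for m
  define lifetime where "lifetime m = (\<Sum>s\<in>S. case q m s of None \<Rightarrow> 0 | Some d \<Rightarrow> d)" for m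
  have "wf (measures [immortal, lifetime])"
    by (rule wf_measures)
  then have "\<exists>m. presented_by M S p (q m) m"
    using m gen
  proof (induction m rule: wf_induct_rule)
    case (less m)
    note m = less.prems(1) and gen = less.prems(2)
    show ?case
    proof (cases "\<forall>i c. c \<in> free_part S p i \<longrightarrow> evaluate M p m i c = \<zero>\<^bsub>part M i\<^esub>
        \<longrightarrow> c \<in> relation_part S (q m) i")
      case True
      have "c \<in> free_part S p i \<and> evaluate M p m i c = \<zero>\<^bsub>part M i\<^esub>"
        if c: "c \<in> relation_part S (q m) i" for c :: "_ \<Rightarrow> 'f" and i
      proof
        have *: "s \<in> S \<and> p s \<le> i \<and> shift M (p s) i (m s) = \<zero>\<^bsub>part M i\<^esub>" if "c s \<noteq> 0" for s
          using c that m annihilation_degree_le[OF M, of "m s" "p s" i]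
          by (auto simp: relation_part_def q_def)
        show "c \<in> free_part S p i"
          using c * by (auto simp: free_part_def relation_part_def)
        interpret abelian_monoid "part M i" by (rule amonoid)
        show "evaluate M p m i c = \<zero>\<^bsub>part M i\<^esub>"
          unfolding evaluate_def by (rule add.finprod_one_eqI) (simp add: * smult_zero)
      qed
      then have "presented_by M S p (q m) m"
        unfolding presented_by_def using True m gen by blast
      then show ?thesis
        by blast
    next
      case False
      then obtain i c where c: "c \<in> free_part S p i" "evaluate M p m i c = \<zero>\<^bsub>part M i\<^esub>"
        "c \<notin> relation_part S (\<lambda>s. annihilation_degree M (p s) (m s)) i"
        by (auto simp: q_def[abs_def])
      from exchange_of_relation[OF M m gen this]
      obtain t w d where t: "t \<in> S" and w: "w \<in> carrier (part M (p t))"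
        and gen': "\<forall>i. evaluate M p (m(t := w)) i ` free_part S p i = carrier (part M i)"
        and d: "annihilation_degree M (p t) w = Some d"
        and less_d: "\<forall>e. annihilation_degree M (p t) (m t) = Some e \<longrightarrow> d < e"
        by blast
      let ?m = "m(t := w)"
      have q_t: "q ?m t = Some d" and q_other: "\<And>s. s \<noteq> t \<Longrightarrow> q ?m s = q m s"
        using d by (simp_all add: q_def)
      have "(?m, m) \<in> measures [immortal, lifetime]"
      proof (cases "q m t")
        case None
        have not_t: "s \<noteq> t" if "q ?m s = None" for s
          using q_t that by auto
        then have "{s \<in> S. q ?m s = None} \<subseteq> {s \<in> S. q m s = None} - {t}"
        proof (intro subsetI)
          fix s assume "s \<in> {s \<in> S. q ?m s = None}"
          then show "s \<in> {s \<in> S. q m s = None} - {t}"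
            using not_t[of s] q_other[of s] by simp
        qed
        then have "{s \<in> S. q ?m s = None} \<subset> {s \<in> S. q m s = None}"
          using t None by blast
        then have "immortal ?m < immortal m"
          unfolding immortal_def by (intro psubset_card_mono) (use fin in auto)
        then show ?thesis
          by simp
      next
        case (Some e)
        have "q ?m s = None \<longleftrightarrow> q m s = None" for s
          using Some q_t q_other by (cases "s = t") auto
        then have "immortal ?m = immortal m"
          by (simp add: immortal_def)
        moreover have "d < e"
          using Some less_d by (simp add: q_def)
        then have "lifetime ?m < lifetime m"
          unfolding lifetime_def
        proof (intro sum_strict_mono_ex1[OF fin] ballI bexI[OF _ t])
          fix s
          show "(case q ?m s of None \<Rightarrow> 0 | Some d \<Rightarrow> d) \<le> (case q m s of None \<Rightarrow> 0 | Some d \<Rightarrow> d)"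
            using Some q_t q_other \<open>d < e\<close> by (cases "s = t") auto
        qed (simp add: Some q_t)
        ultimately show ?thesis
          by simp
      qed
      moreover have "\<forall>s\<in>S. ?m s \<in> carrier (part M (p s))"
        using m w by simp
      ultimately show ?thesis
        using less.IH gen' by blast
    qed
  qed
  then show ?thesis
    unfolding q_def .
qed

text \<open>
  Numbers the elements of a finite set that have the same label: new elements receive the
  multiplicity reached so far as their number.
\<close>

lemma copies_enumeration:
  assumes "finite A"
  shows "\<exists>\<sigma>. bij_betw \<sigma> (copies (image_mset h (mset_set A))) A
    \<and> (\<forall>x \<in> copies (image_mset h (mset_set A)). h (\<sigma> x) = fst x)"
  using assms
proof (induction A rule: finite_induct)
  case empty
  then show ?case
    by (simp add: copies_def bij_betw_def)
next
  case (insert a A)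
  let ?B = "image_mset h (mset_set A)"
  from insert.IH obtain \<sigma> where \<sigma>: "bij_betw \<sigma> (copies ?B) A" "\<forall>x\<in>copies ?B. h (\<sigma> x) = fst x"
    by blast
  define n where "n = (h a, count ?B (h a))"
  have n: "n \<notin> copies ?B"
    by (simp add: copies_def n_def)
  have "copies (image_mset h (mset_set (insert a A))) = insert n (copies ?B)"
    using insert.hyps by (auto simp: copies_def n_def split: if_splits)
  moreover have "bij_betw (\<sigma>(n := a)) (insert n (copies ?B)) (insert a A)"
  proof -
    have "bij_betw (\<sigma>(n := a)) (copies ?B) A"
      using \<sigma>(1) n by (subst bij_betw_cong[of _ _ \<sigma>]) auto
    then show ?thesis
      using notIn_Un_bij_betw[of n "copies ?B" "\<sigma>(n := a)" A] insert.hyps(2) n by simp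
  qed
  moreover have "\<forall>x\<in>insert n (copies ?B). h ((\<sigma>(n := a)) x) = fst x"
    using \<sigma>(2) by (simp add: n_def)
  ultimately show ?case
    by metis
qed

lemma survival_eq_bar:
  "survival b (finite_degree d) = {i. b \<le> i \<and> enat i < d}"
  by (cases d) (auto simp: survival_def)

lemma finite_degree_inverse:
  "finite_degree (case d of None \<Rightarrow> \<infinity> | Some d \<Rightarrow> enat d) = d"
  by (cases d) simp_all

text \<open>
  The generators obtained by exchanging are nonzero after those that die at birth have been
  dropped, and their births and deaths are the bars.
\<close>

lemma exists_interval_decomposition:
  fixes M :: "(nat, 'f::field, 'v) persistence_module"
  assumes M: "graded_module M" and "finite_type M"
  shows "\<exists>B. interval_decomposition M B"
proof -
  from assms(2) obtain G where G: "G \<subseteq> (SIGMA i:UNIV. carrier (part M i))" "finite G"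
    and gen: "\<forall>i. evaluate M fst snd i ` free_part G fst i = carrier (part M i)"
    unfolding finite_type_def by metis
  have "\<forall>s\<in>G. snd s \<in> carrier (part M (fst s))"
    using G(1) by auto
  from exists_presentation[OF M G(2) this gen] obtain m where
    pres: "presented_by M G fst (\<lambda>s. annihilation_degree M (fst s) (m s)) m"
    by blast
  define q where "q s = annihilation_degree M (fst s) (m s)" for s
  define S where "S = {s \<in> G. q s \<noteq> Some (fst s)}"
  have mG: "\<forall>s\<in>G. m s \<in> carrier (part M (fst s))"
    using pres by (simp add: presented_by_def)
  have less: "fst s < d" if "s \<in> S" "q s = Some d" for s d
  proof -
    have "fst s \<le> d"
      using that mG annihilation_degree_le[OF M, of "m s" "fst s" d] by (auto simp: S_def q_def)
    then show ?thesis
      using that by (auto simp: S_def le_less)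
  qed
  have "presented_by M S fst q m"
    by (rule graded_module.presented_drop_zero_generators[OF M, of G])
      (use pres in \<open>auto simp: S_def q_def[abs_def]\<close>)
  then have iso: "isomorphic M (direct_sum S (\<lambda>s. interval_module (survival (fst s) (q s))))"
    by (rule graded_module.presented_imp_isomorphic[OF M])
  define h where "h s = (fst s, case q s of None \<Rightarrow> \<infinity> | Some d \<Rightarrow> enat d)" for s
  define B where "B = image_mset h (mset_set S)"
  have "finite S"
    using G(2) by (simp add: S_def)
  from copies_enumeration[OF this, of h] obtain \<sigma> where
    \<sigma>: "bij_betw \<sigma> (copies B) S" "\<And>x. x \<in> copies B \<Longrightarrow> h (\<sigma> x) = fst x"
    unfolding B_def by blast
  have "interval_module {i. birth x \<le> i \<and> enat i < death x}
      = interval_module (survival (fst (\<sigma> x)) (q (\<sigma> x)))" if "x \<in> copies B" for x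
  proof -
    have "birth x = fst (\<sigma> x)" "finite_degree (death x) = q (\<sigma> x)"
      using \<sigma>(2)[OF that, symmetric] by (simp_all add: birth_def death_def h_def finite_degree_inverse)
    then show ?thesis
      using survival_eq_bar[of "birth x" "death x"] by simp
  qed
  then have "isomorphic (direct_sum S (\<lambda>s. interval_module (survival (fst s) (q s))))
      (direct_sum (copies B) (\<lambda>s. interval_module {i. birth s \<le> i \<and> enat i < death s}))"
    by (rule isomorphic_direct_sum_reindex[OF \<sigma>(1)])
  from isomorphic_trans[OF iso this] have "interval_decomposition M B"
    unfolding interval_decomposition_def
    using less \<open>finite S\<close> by (auto simp: B_def h_def split: option.split)
  then show ?thesis ..
qed

section \<open>Hook decomposition of the product\<close>

lemma copies_bar_nonempty:
  assumes "interval_decomposition M B" and "s \<in> copies B"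
  shows "enat (birth s) < death s"
proof -
  obtain b d n where s: "s = ((b, d), n)"
    by (metis surj_pair)
  then have "(b, d) \<in># B"
    using assms(2) by (auto simp: copies_def simp flip: count_greater_zero_iff)
  then show ?thesis
    using assms(1) by (auto simp: interval_decomposition_def birth_def death_def s)
qed

text \<open>
  The points of \<open>S\<close> that are not bars lie on the diagonal and contribute zero generators.
\<close>

lemma exists_bar_generators:
  assumes M: "graded_module M" and B: "interval_decomposition M B"
    and "copies B \<subseteq> S" and S: "S \<subseteq> copies B \<union> {s. on_diagonal s}"
  shows "\<exists>m. bar_generators M S m"
  unfolding bar_generators_def
proof (rule graded_module.isomorphic_imp_presented[OF M _ \<open>copies B \<subseteq> S\<close>])
  show "isomorphic M (direct_sum (copies B)
      (\<lambda>s. interval_module (survival (birth s) (finite_degree (death s)))))"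
    using B by (simp add: interval_decomposition_def survival_eq_bar)
  show "birth t \<le> d" if "t \<in> S" "finite_degree (death t) = Some d" for t d
    using that S copies_bar_nonempty[OF B, of t] by (cases "death t") (auto simp: on_diagonal_def)
  show "finite_degree (death t) = Some (birth t)" if "t \<in> S - copies B" for t
    using that S by (auto simp: on_diagonal_def)
qed

lemma interval_decomposition_barcode:
  assumes "graded_module M" and "finite_type M"
  shows "interval_decomposition M (barcode M)"
  unfolding barcode_def using someI_ex[OF exists_interval_decomposition[OF assms]] .

lemma birth_le_death:
  assumes "graded_module M" and "finite_type M" and "s \<in> persistence_diagram M"
  shows "enat (birth s) \<le> death s"
  using assms(3) copies_bar_nonempty[OF interval_decomposition_barcode[OF assms(1,2)], of s]
  by (auto simp: persistence_diagram_def on_diagonal_def)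

text \<open>
  The sets of diagram points selected by a matching are of this kind on both sides: a point
  is left out only if it and its partner lie on the diagonal.
\<close>

lemma bar_generators_diagram:
  assumes M: "graded_module M" "finite_type M"
    and "S \<subseteq> persistence_diagram M" and "{s \<in> persistence_diagram M. \<not> on_diagonal s} \<subseteq> S"
  shows "bar_generators M S (SOME m. bar_generators M S m)"
proof -
  have "\<not> on_diagonal s" if "s \<in> copies (barcode M)" for s
    using copies_bar_nonempty[OF interval_decomposition_barcode[OF M] that]
    by (auto simp: on_diagonal_def)
  then have "copies (barcode M) \<subseteq> S"
    using assms(4) by (auto simp: persistence_diagram_def)
  moreover have "S \<subseteq> copies (barcode M) \<union> {s. on_diagonal s}"
    using assms(3) by (simp add: persistence_diagram_def)
  ultimately show ?thesis
    using someI_ex[OF exists_bar_generators[OF M(1) interval_decomposition_barcode[OF M]]] by blast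
qed

lemma hook_eq_survival: "hook (Some p) q = survival p q"
  by (cases q) (auto simp: hook_def survival_def)

text \<open>
  Transports a countable index set to the natural numbers.
\<close>

lemma hook_decomposable_sum:
  fixes S :: "'s::countable set"
  assumes iso: "isomorphic M (direct_sum S (\<lambda>s. interval_module (hook (p s) (q s))))"
    and le: "\<And>s. s \<in> S \<Longrightarrow> ext_le (p s) (q s)"
  shows "hook_decomposable M"
  unfolding hook_decomposable_def
proof (intro exI conjI ballI)
  let ?I = "to_nat ` S"
  show "ext_le (p (from_nat n)) (q (from_nat n))" if "n \<in> ?I" for n
    using that le by auto
  have "bij_betw from_nat ?I S"
    by (rule bij_betw_byWitness[where f' = to_nat]) auto
  from isomorphic_trans[OF iso isomorphic_direct_sum_reindex[OF this]]
  show "isomorphic M (direct_sum ?I (\<lambda>n. interval_module (hook (p (from_nat n)) (q (from_nat n)))))"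
    by simp
qed

text \<open>
  The relation of a pair of matched generators sits at the pair of their deaths, if both are
  finite. This pair lies above the pair of their births, so the two bound a hook.
\<close>

lemma hook_decomposable_product_of_generators:
  fixes M :: "(nat, 'f::field, 'v) persistence_module" and N :: "(nat, 'f, 'w) persistence_module"
  assumes M: "graded_module M" and N: "graded_module N" and inj: "inj_on \<gamma> S"
    and m: "bar_generators M S m" and m': "bar_generators N (\<gamma> ` S) m'"
    and le: "\<And>s. s \<in> S \<Longrightarrow> enat (birth s) \<le> death s"
      "\<And>s. s \<in> S \<Longrightarrow> enat (birth (\<gamma> s)) \<le> death (\<gamma> s)"
  shows "hook_decomposable (product_of_generators M N S \<gamma> m m')"
proof -
  let ?p = "\<lambda>s. (birth s, birth (\<gamma> s))" and ?q = "\<lambda>s. product_relation s (\<gamma> s)"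
  let ?m = "\<lambda>s. (m s, m' (\<gamma> s))"
  have le_relation: "?p s \<le> d" if "s \<in> S" "?q s = Some d" for s d
    using that le[of s]
    by (cases "death s"; cases "death (\<gamma> s)") (auto simp: product_relation_def)
  have "isomorphic (generated_submodule (pair_module M N) S ?p ?m)
      (direct_sum S (\<lambda>s. interval_module (survival (?p s) (?q s))))"
  proof (rule graded_module.isomorphic_generated_submodule[OF graded_pair[OF M N]])
    show "\<forall>s\<in>S. ?m s \<in> carrier (part (pair_module M N) (?p s))"
      using m m' by (simp add: bar_generators_def presented_by_def pair_module_def)
    show "{c \<in> free_part S ?p i. evaluate (pair_module M N) ?p ?m i c = \<zero>\<^bsub>part (pair_module M N) i\<^esub>}
        = relation_part S ?q i" for i
    proof -
      have "c \<in> free_part S ?p i" if "c \<in> relation_part S ?q i" for c :: "_ \<Rightarrow> 'f"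
        using that le_relation unfolding free_part_def relation_part_def
        by (blast intro: order_trans)
      then show ?thesis
        using product_relations[OF M N inj m m', of _ "fst i" "snd i"] by auto
    qed
  qed
  then have "isomorphic (product_of_generators M N S \<gamma> m m')
      (direct_sum S (\<lambda>s. interval_module (hook (Some (?p s)) (?q s))))"
    by (simp add: product_of_generators_def hook_eq_survival)
  moreover have "ext_le (Some (?p s)) (?q s)" if "s \<in> S" for s
    using le_relation[OF that] by (cases "?q s") auto
  ultimately show ?thesis
    by (rule hook_decomposable_sum)
qed

theorem proposition2:
  fixes X :: "'a topology" and f g :: "'a \<Rightarrow> nat" and k :: nat
    and M_f M_g :: "(nat, 'f::field, ('a, 'f) field_chain set) persistence_module"
    and M_fg :: "(nat \<times> nat, 'f, ('a, 'f) field_chain set) persistence_module"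
    and \<gamma> :: "point \<Rightarrow> point"
  assumes "continuous_map X euclidean f" and "continuous_map X euclidean g"
    and "M_f = sublevel_homology k X f"
    and "M_g = sublevel_homology k X g"
    and "M_fg = sublevel_homology k X (\<lambda>x. (f x, g x))"
    and "finite_type M_f" and "finite_type M_g" and "finite_type M_fg"
    and "bij_betw \<gamma> (persistence_diagram M_f) (persistence_diagram M_g)"
  shows "hook_decomposable (gamma_product M_f \<gamma> M_g)"
proof -
  have f: "graded_module M_f" and g: "graded_module M_g"
    using assms(3,4) graded_module_sublevel_homology by auto
  define S where "S = matched_points (persistence_diagram M_f) \<gamma>"
  have S: "S = {s \<in> persistence_diagram M_f. \<not> (on_diagonal s \<and> on_diagonal (\<gamma> s))}"
    by (auto simp: S_def matched_points_def)
  have inj: "inj_on \<gamma> (persistence_diagram M_f)"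
    and im: "\<gamma> ` persistence_diagram M_f = persistence_diagram M_g"
    using assms(9) by (auto simp: bij_betw_def)
  have "hook_decomposable (product_of_generators M_f M_g S \<gamma>
      (SOME m. bar_generators M_f S m) (SOME m'. bar_generators M_g (\<gamma> ` S) m'))"
  proof (rule hook_decomposable_product_of_generators[OF f g])
    show "inj_on \<gamma> S"
      using inj by (rule inj_on_subset) (auto simp: S)
    show "bar_generators M_f S (SOME m. bar_generators M_f S m)"
      by (rule bar_generators_diagram[OF f assms(6)]) (auto simp: S)
    show "bar_generators M_g (\<gamma> ` S) (SOME m'. bar_generators M_g (\<gamma> ` S) m')"
    proof (rule bar_generators_diagram[OF g assms(7)])
      show "\<gamma> ` S \<subseteq> persistence_diagram M_g"
        using im by (auto simp: S)
      show "{t \<in> persistence_diagram M_g. \<not> on_diagonal t} \<subseteq> \<gamma> ` S"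
        unfolding im[symmetric] S by auto
    qed
    show "enat (birth s) \<le> death s" if "s \<in> S" for s
      using birth_le_death[OF f assms(6)] that by (simp add: S)
    show "enat (birth (\<gamma> s)) \<le> death (\<gamma> s)" if "s \<in> S" for s
      using birth_le_death[OF g assms(7), of "\<gamma> s"] that im by (auto simp: S)
  qed
  then show ?thesis
    by (simp add: gamma_product_def Let_def S_def)
qed

end
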